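(* Let $(M,g)$ be a light-like manifold with constant index and nullity degree $r$. Assume that $Rad(TM)$ is a trivial bundle, with everywhere linearly independent vector fields $\xi_i\in\Gamma(Rad(TM))$, $i=1,\dots,r$. Let $\tau_i$ ($i=1,\dots,r$) be smooth 1-forms on $M$ satisfying $\tau_i(\xi_j)=\delta_{ij}$ for $i,j=1,\dots,r$. Assume that the 1-forms $\tau_i$ are closed and that $L_{\xi_i}g=0$ for $i=1,\dots,r$. Then there exists a unique torsion-free and $g$-compatible (i.e. $\nabla g=0$) linear connection $\nabla$ on $M$ with $\nabla\tau_i=0$ for $i=1,\dots,r$.
   Context: A light-like manifold $(M,g)$ is a smooth manifold $M$ with a smooth symmetric $(0,2)$-tensor field $g$ of constant index and constant nullity degree (co-rank). $Rad(TM)$ is the radical of $g$: the subbundle of $TM$ with fibres $Rad(T_xM)=\{v\in T_xM : g(v,w)=0 \text{ for all } w\in T_xM\}$; its rank equals the nullity degree. $\Gamma(E)$ denotes the space of smooth sections of a bundle $E$. $L$ denotes the Lie derivative. Conventions: $(\nabla_Zg)(X,Y)=Z(g(X,Y))-g(\nabla_ZX,Y)-g(X,\nabla_ZY)$, $(\nabla_X\tau)(Y)=X(\tau(Y))-\tau(\nabla_XY)$. *)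

theory Defs
  imports
    "HOL-Analysis.Analysis"
    "HOL-Library.Function_Algebras"
    "HOL-Library.FuncSet"
begin

section \<open>Smooth manifolds and smooth functions\<close>

text \<open>
  \<open>Ck_on k S f\<close> is only meant for open \<open>S\<close>. Since the domain will be
  finite-dimensional, continuity of all directional derivatives is continuity of the derivative.
\<close>

primrec Ck_on ::
  "nat \<Rightarrow> 'a::real_normed_vector set \<Rightarrow> ('a \<Rightarrow> 'b::real_normed_vector) \<Rightarrow> bool" where
  "Ck_on 0 S f \<longleftrightarrow> continuous_on S f"
| "Ck_on (Suc k) S f \<longleftrightarrow>
     (\<forall>x\<in>S. f differentiable (at x)) \<and>
     (\<forall>v. Ck_on k S (\<lambda>x. frechet_derivative f (at x) v))"

definition smooth_on ::
  "'a::real_normed_vector set \<Rightarrow> ('a \<Rightarrow> 'b::real_normed_vector) \<Rightarrow> bool" where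
  "smooth_on S f \<longleftrightarrow> (\<forall>k. Ck_on k S f)"

text \<open>
  A chart is a pair \<open>(U, \<phi>)\<close> of a domain and a coordinate map; the values of \<open>\<phi>\<close>
  outside \<open>U\<close> are irrelevant. The manifold is the whole type \<open>'m\<close>, whose topology is
  Hausdorff and second countable; its dimension is \<open>DIM('e)\<close>. The atlas need not be maximal.
\<close>

type_synonym ('m, 'e) chart = "'m set \<times> ('m \<Rightarrow> 'e)"

definition smooth_atlas ::
  "('m::{t2_space, second_countable_topology}, 'e::euclidean_space) chart set \<Rightarrow> bool" where
  "smooth_atlas A \<longleftrightarrow>
     (\<forall>(U, \<phi>)\<in>A. open U \<and> open (\<phi> ` U) \<and> homeomorphism U (\<phi> ` U) \<phi> (inv_into U \<phi>)) \<and>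
     (\<Union>(U, \<phi>)\<in>A. U) = UNIV \<and>
     (\<forall>(U, \<phi>)\<in>A. \<forall>(V, \<psi>)\<in>A. smooth_on (\<phi> ` (U \<inter> V)) (\<psi> \<circ> inv_into U \<phi>))"

definition smooth_fun ::
  "('m, 'e::euclidean_space) chart set \<Rightarrow> ('m \<Rightarrow> real) \<Rightarrow> bool" where
  "smooth_fun A f \<longleftrightarrow> (\<forall>(U, \<phi>)\<in>A. smooth_on (\<phi> ` U) (f \<circ> inv_into U \<phi>))"


section \<open>Tangent spaces and vector fields\<close>

text \<open>
  Tangent vectors are point derivations of the algebra of smooth functions. They form subspaces
  of the space of all functionals \<open>('m \<Rightarrow> real) \<Rightarrow> real\<close>, in which \<open>fspace.subspace\<close>,
  \<open>fspace.independent\<close> and \<open>fspace.dim\<close> are taken.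
\<close>

definition fscale :: "real \<Rightarrow> ('a \<Rightarrow> real) \<Rightarrow> 'a \<Rightarrow> real" where
  "fscale c v = (\<lambda>x. c * v x)"

interpretation fspace: vector_space "fscale :: real \<Rightarrow> ('a \<Rightarrow> real) \<Rightarrow> 'a \<Rightarrow> real"
  by unfold_locales (auto simp: fscale_def fun_eq_iff algebra_simps)

type_synonym 'm tangent = "('m \<Rightarrow> real) \<Rightarrow> real"
type_synonym 'm vfield = "'m \<Rightarrow> 'm tangent"

text \<open>
  The last clause fixes the irrelevant values on non-smooth functions, so that two tangent
  vectors are equal as soon as they agree on smooth functions.
\<close>

definition tangent_space ::
  "('m, 'e::euclidean_space) chart set \<Rightarrow> 'm \<Rightarrow> 'm tangent set" where
  "tangent_space A p = {v.
     (\<forall>f h. smooth_fun A f \<longrightarrow> smooth_fun A h \<longrightarrow> v (\<lambda>q. f q + h q) = v f + v h) \<and>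
     (\<forall>c f. smooth_fun A f \<longrightarrow> v (\<lambda>q. c * f q) = c * v f) \<and>
     (\<forall>f h. smooth_fun A f \<longrightarrow> smooth_fun A h \<longrightarrow>
        v (\<lambda>q. f q * h q) = f p * v h + h p * v f) \<and>
     (\<forall>f. \<not> smooth_fun A f \<longrightarrow> v f = 0)}"

definition vector_fields ::
  "('m, 'e::euclidean_space) chart set \<Rightarrow> 'm vfield set" where
  "vector_fields A = {X.
     (\<forall>p. X p \<in> tangent_space A p) \<and>
     (\<forall>f. smooth_fun A f \<longrightarrow> smooth_fun A (\<lambda>p. X p f))}"

definition lie_bracket :: "'m vfield \<Rightarrow> 'm vfield \<Rightarrow> 'm vfield" where
  "lie_bracket X Y = (\<lambda>p f. X p (\<lambda>q. Y q f) - Y p (\<lambda>q. X q f))"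


section \<open>One-forms and symmetric tensor fields\<close>

type_synonym 'm covector_field = "'m \<Rightarrow> 'm tangent \<Rightarrow> real"
type_synonym 'm tensor_field2 = "'m \<Rightarrow> 'm tangent \<Rightarrow> 'm tangent \<Rightarrow> real"

definition linear_on_tangent ::
  "('m, 'e::euclidean_space) chart set \<Rightarrow> 'm \<Rightarrow> ('m tangent \<Rightarrow> real) \<Rightarrow> bool" where
  "linear_on_tangent A p \<alpha> \<longleftrightarrow>
     (\<forall>v\<in>tangent_space A p. \<forall>w\<in>tangent_space A p. \<alpha> (v + w) = \<alpha> v + \<alpha> w) \<and>
     (\<forall>c. \<forall>v\<in>tangent_space A p. \<alpha> (fscale c v) = c * \<alpha> v)"

definition one_forms ::
  "('m, 'e::euclidean_space) chart set \<Rightarrow> 'm covector_field set" where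
  "one_forms A = {\<tau>.
     (\<forall>p. linear_on_tangent A p (\<tau> p)) \<and>
     (\<forall>X\<in>vector_fields A. smooth_fun A (\<lambda>p. \<tau> p (X p)))}"

definition symmetric_tensor_fields ::
  "('m, 'e::euclidean_space) chart set \<Rightarrow> 'm tensor_field2 set" where
  "symmetric_tensor_fields A = {g.
     (\<forall>p. \<forall>v\<in>tangent_space A p. linear_on_tangent A p (g p v)) \<and>
     (\<forall>p. \<forall>v\<in>tangent_space A p. \<forall>w\<in>tangent_space A p. g p v w = g p w v) \<and>
     (\<forall>X\<in>vector_fields A. \<forall>Y\<in>vector_fields A. smooth_fun A (\<lambda>p. g p (X p) (Y p)))}"

text \<open>The exterior derivative, as a function of two vector fields.\<close>

definition ext_deriv ::
  "'m covector_field \<Rightarrow> 'm vfield \<Rightarrow> 'm vfield \<Rightarrow> 'm \<Rightarrow> real" where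
  "ext_deriv \<tau> X Y = (\<lambda>p.
     X p (\<lambda>q. \<tau> q (Y q)) - Y p (\<lambda>q. \<tau> q (X q)) - \<tau> p (lie_bracket X Y p))"

definition closed_form ::
  "('m, 'e::euclidean_space) chart set \<Rightarrow> 'm covector_field \<Rightarrow> bool" where
  "closed_form A \<tau> \<longleftrightarrow>
     (\<forall>X\<in>vector_fields A. \<forall>Y\<in>vector_fields A. \<forall>p. ext_deriv \<tau> X Y p = 0)"

text \<open>\<open>lie_deriv Z g X Y\<close> is \<open>(L\<^sub>Z g)(X, Y)\<close>.\<close>

definition lie_deriv ::
  "'m vfield \<Rightarrow> 'm tensor_field2 \<Rightarrow> 'm vfield \<Rightarrow> 'm vfield \<Rightarrow> 'm \<Rightarrow> real" where
  "lie_deriv Z g X Y = (\<lambda>p.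
     Z p (\<lambda>q. g q (X q) (Y q)) - g p (lie_bracket Z X p) (Y p) - g p (X p) (lie_bracket Z Y p))"


section \<open>Light-like manifolds\<close>

definition radical ::
  "('m, 'e::euclidean_space) chart set \<Rightarrow> 'm tensor_field2 \<Rightarrow> 'm \<Rightarrow> 'm tangent set" where
  "radical A g p = {v \<in> tangent_space A p. \<forall>w\<in>tangent_space A p. g p v w = 0}"

definition radical_sections ::
  "('m, 'e::euclidean_space) chart set \<Rightarrow> 'm tensor_field2 \<Rightarrow> 'm vfield set" where
  "radical_sections A g = {X \<in> vector_fields A. \<forall>p. X p \<in> radical A g p}"

definition nullity_degree ::
  "('m, 'e::euclidean_space) chart set \<Rightarrow> 'm tensor_field2 \<Rightarrow> 'm \<Rightarrow> nat" where
  "nullity_degree A g p = fspace.dim (radical A g p)"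

text \<open>The largest dimension of a subspace on which the form is negative definite.\<close>

definition tensor_index ::
  "('m, 'e::euclidean_space) chart set \<Rightarrow> 'm tensor_field2 \<Rightarrow> 'm \<Rightarrow> nat" where
  "tensor_index A g p = Max {fspace.dim W | W.
     fspace.subspace W \<and> W \<subseteq> tangent_space A p \<and> (\<forall>v\<in>W. v \<noteq> 0 \<longrightarrow> g p v v < 0)}"

definition light_like_manifold ::
  "('m::{t2_space, second_countable_topology}, 'e::euclidean_space) chart set \<Rightarrow>
    'm tensor_field2 \<Rightarrow> nat \<Rightarrow> nat \<Rightarrow> bool" where
  "light_like_manifold A g \<nu> r \<longleftrightarrow>
     smooth_atlas A \<and> g \<in> symmetric_tensor_fields A \<and>
     (\<forall>p. tensor_index A g p = \<nu>) \<and> (\<forall>p. nullity_degree A g p = r)"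


section \<open>Linear connections\<close>

type_synonym 'm connection = "'m vfield \<Rightarrow> 'm vfield \<Rightarrow> 'm vfield"

text \<open>
  A connection is a map on pairs of smooth vector fields. The extensional function space makes
  it \<open>undefined\<close> on other arguments, so that equality of connections is equality on smooth
  vector fields.
\<close>

definition linear_connection ::
  "('m, 'e::euclidean_space) chart set \<Rightarrow> 'm connection \<Rightarrow> bool" where
  "linear_connection A D \<longleftrightarrow>
     D \<in> vector_fields A \<rightarrow>\<^sub>E (vector_fields A \<rightarrow>\<^sub>E vector_fields A) \<and>
     (\<forall>X\<in>vector_fields A. \<forall>X'\<in>vector_fields A. \<forall>Y\<in>vector_fields A.
        D (\<lambda>p. X p + X' p) Y = (\<lambda>p. D X Y p + D X' Y p)) \<and>
     (\<forall>f. \<forall>X\<in>vector_fields A. \<forall>Y\<in>vector_fields A. smooth_fun A f \<longrightarrow>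
        D (\<lambda>p. fscale (f p) (X p)) Y = (\<lambda>p. fscale (f p) (D X Y p))) \<and>
     (\<forall>X\<in>vector_fields A. \<forall>Y\<in>vector_fields A. \<forall>Y'\<in>vector_fields A.
        D X (\<lambda>p. Y p + Y' p) = (\<lambda>p. D X Y p + D X Y' p)) \<and>
     (\<forall>f. \<forall>X\<in>vector_fields A. \<forall>Y\<in>vector_fields A. smooth_fun A f \<longrightarrow>
        D X (\<lambda>p. fscale (f p) (Y p)) =
          (\<lambda>p. fscale (X p f) (Y p) + fscale (f p) (D X Y p)))"

definition torsion_free ::
  "('m, 'e::euclidean_space) chart set \<Rightarrow> 'm connection \<Rightarrow> bool" where
  "torsion_free A D \<longleftrightarrow>
     (\<forall>X\<in>vector_fields A. \<forall>Y\<in>vector_fields A. \<forall>p.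
        D X Y p - D Y X p = lie_bracket X Y p)"

text \<open>\<open>cov_deriv_tensor D g Z X Y\<close> is \<open>(D\<^sub>Z g)(X, Y)\<close>.\<close>

definition cov_deriv_tensor ::
  "'m connection \<Rightarrow> 'm tensor_field2 \<Rightarrow> 'm vfield \<Rightarrow> 'm vfield \<Rightarrow> 'm vfield \<Rightarrow> 'm \<Rightarrow> real" where
  "cov_deriv_tensor D g Z X Y = (\<lambda>p.
     Z p (\<lambda>q. g q (X q) (Y q)) - g p (D Z X p) (Y p) - g p (X p) (D Z Y p))"

definition metric_compatible ::
  "('m, 'e::euclidean_space) chart set \<Rightarrow> 'm tensor_field2 \<Rightarrow> 'm connection \<Rightarrow> bool" where
  "metric_compatible A g D \<longleftrightarrow>
     (\<forall>Z\<in>vector_fields A. \<forall>X\<in>vector_fields A. \<forall>Y\<in>vector_fields A. \<forall>p.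
        cov_deriv_tensor D g Z X Y p = 0)"

text \<open>\<open>cov_deriv_form D \<tau> X Y\<close> is \<open>(D\<^sub>X \<tau>)(Y)\<close>.\<close>

definition cov_deriv_form ::
  "'m connection \<Rightarrow> 'm covector_field \<Rightarrow> 'm vfield \<Rightarrow> 'm vfield \<Rightarrow> 'm \<Rightarrow> real" where
  "cov_deriv_form D \<tau> X Y = (\<lambda>p. X p (\<lambda>q. \<tau> q (Y q)) - \<tau> p (D X Y p))"

definition parallel_form ::
  "('m, 'e::euclidean_space) chart set \<Rightarrow> 'm connection \<Rightarrow> 'm covector_field \<Rightarrow> bool" where
  "parallel_form A D \<tau> \<longleftrightarrow>
     (\<forall>X\<in>vector_fields A. \<forall>Y\<in>vector_fields A. \<forall>p. cov_deriv_form D \<tau> X Y p = 0)"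

end

theory Submission
  imports Defs
begin

text \<open>
  Write \<open>[X, Y]\<close> for the Lie bracket. A torsion-free connection with \<open>\<nabla>g = 0\<close> obeys the Koszul
  identity (\<open>koszul_formula\<close>): \<open>2 g(\<nabla>\<^sub>X Y, Z)\<close> equals an expression
  \<open>K(X, Y, Z)\<close> in brackets, \<open>g\<close> and its derivatives.
  As \<open>g\<close> is degenerate, this determines \<open>\<nabla>\<^sub>X Y\<close> only up to the radical. The missing part is
  supplied by \<open>\<nabla>\<tau>\<^sub>i = 0\<close>, which says \<open>\<tau>\<^sub>i(\<nabla>\<^sub>X Y) = X(\<tau>\<^sub>i(Y))\<close>. The two
  conditions together prescribe the pairing of \<open>\<nabla>\<^sub>X Y\<close> with every \<open>Z\<close> under
  \<open>h = g + \<Sum>\<^sub>i \<tau>\<^sub>i \<otimes> \<tau>\<^sub>i\<close>. This \<open>h\<close> is nondegenerate: a vector \<open>v\<close> that is \<open>h\<close>-orthogonal to all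
  \<open>\<xi>\<^sub>i\<close> has \<open>\<tau>\<^sub>i(v) = 0\<close>; if it is \<open>h\<close>-orthogonal to everything, it then lies in the radical,
  which is spanned by the \<open>\<xi>\<^sub>i\<close>, and so vanishes as the \<open>\<tau>\<^sub>i\<close> read off its coefficients
  (\<open>total_metric_nondegenerate\<close>). Uniqueness follows.

  For existence, define \<open>\<nabla>\<^sub>X Y\<close> as the \<open>h\<close>-dual of
  \<open>Z \<mapsto> K(X, Y, Z) / 2 + \<Sum>\<^sub>i X(\<tau>\<^sub>i(Y)) \<tau>\<^sub>i(Z)\<close>. Evaluating at \<open>Z = \<xi>\<^sub>i\<close> gives
  \<open>\<tau>\<^sub>i(\<nabla>\<^sub>X Y) = X(\<tau>\<^sub>i(Y))\<close>, because
  \<open>K(X, Y, Z) = -(L\<^sub>Z g)(X, Y) = 0\<close> for \<open>Z = \<xi>\<^sub>i\<close> (\<open>koszul_xi\<close>);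
  subtracting the \<open>\<tau>\<close>-part gives \<open>2 g(\<nabla>\<^sub>X Y, Z) = K(X, Y, Z)\<close>. The connection axioms and \<open>\<nabla>g = 0\<close> then
  follow from the behaviour of \<open>K\<close> in each argument. The torsion vanishes because
  \<open>K(X, Y, Z) - K(Y, X, Z) = 2 g([X, Y], Z)\<close> settles its \<open>g\<close>-part and closedness of the \<open>\<tau>\<^sub>i\<close>
  its \<open>\<tau>\<close>-part.

  The remaining work is to show that a functional on vector fields that is linear over the smooth
  functions has an \<open>h\<close>-dual which is again a smooth vector field (\<open>sharp_exists\<close>). This needs local
  frames for tangent spaces made of derivations (\<open>local_frame_exists\<close>). They are obtained from
  Hadamard's lemma,
  \<open>f(x) = f(a) + \<Sum>\<^sub>b (x - a)\<^sub>b G\<^sub>b(x)\<close>, which shows that a derivation is determined by its values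
  on the coordinates, and from bump functions, which turn local functions and fields into global
  ones. In a frame the dual field solves a linear system with smooth coefficients, and Gaussian
  elimination shows that the solution is smooth (\<open>smooth_fun_on_solution\<close>).
\<close>

section \<open>Calculus of smooth functions\<close>

lemma Ck_on_cong:
  assumes "open S" "\<And>x. x \<in> S \<Longrightarrow> f x = g x" "Ck_on k S f"
  shows "Ck_on k S g"
  using assms(2,3)
proof (induction k arbitrary: f g)
  case 0
  then show ?case by (simp cong: continuous_on_cong)
next
  case (Suc k)
  have d: "f differentiable (at x)" if "x \<in> S" for x
    using Suc.prems(2) that by simp
  have "g differentiable (at x)" if "x \<in> S" for x
  proof -
    obtain D where "(f has_derivative D) (at x)" using d[OF \<open>x \<in> S\<close>] by (auto simp: differentiable_def)
    then have "(g has_derivative D) (at x)"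
      by (rule has_derivative_transform_within_open[OF _ assms(1) that]) (rule Suc.prems(1))
    then show ?thesis by (auto simp: differentiable_def)
  qed
  moreover have "frechet_derivative f (at x) = frechet_derivative g (at x)" if "x \<in> S" for x
    using frechet_derivative_transform_within_open[OF d[OF that] assms(1) that Suc.prems(1)] by blast
  then have "Ck_on k S (\<lambda>x. frechet_derivative g (at x) v)" for v
    using Suc.IH[of "\<lambda>x. frechet_derivative f (at x) v"] Suc.prems(2) by auto
  ultimately show ?case by simp
qed

lemma Ck_on_subset: "Ck_on k T f \<Longrightarrow> S \<subseteq> T \<Longrightarrow> Ck_on k S f"
  by (induction k arbitrary: f) (auto intro: continuous_on_subset)

lemma Ck_on_Suc_imp: "Ck_on (Suc k) S f \<Longrightarrow> Ck_on k S f"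
proof (induction k arbitrary: f)
  case 0
  then show ?case
    by (auto simp: differentiable_imp_continuous_within intro!: continuous_at_imp_continuous_on)
next
  case (Suc k)
  then show ?case by simp
qed

lemma Ck_on_local:
  assumes "\<And>x. x \<in> S \<Longrightarrow> \<exists>T. open T \<and> x \<in> T \<and> Ck_on k T f"
  shows "Ck_on k S f"
  using assms
proof (induction k arbitrary: f)
  case 0
  then show ?case
    by (auto intro!: continuous_at_imp_continuous_on simp: continuous_on_eq_continuous_at)
       (metis "0" Ck_on.simps(1) continuous_on_eq_continuous_at)
next
  case (Suc k)
  show ?case
  proof (simp, intro conjI ballI allI)
    show "f differentiable (at x)" if "x \<in> S" for x
      using Suc.prems[OF that] by auto
    show "Ck_on k S (\<lambda>x. frechet_derivative f (at x) v)" for v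
      by (rule Suc.IH) (use Suc.prems in force)
  qed
qed

lemma Ck_on_SucI:
  assumes "open S"
    and "\<And>x. x \<in> S \<Longrightarrow> (f has_derivative D x) (at x)"
    and "\<And>v. Ck_on k S (\<lambda>x. D x v)"
  shows "Ck_on (Suc k) S f"
proof -
  have "frechet_derivative f (at x) = D x" if "x \<in> S" for x
    using frechet_derivative_at[OF assms(2)[OF that]] by simp
  then have "Ck_on k S (\<lambda>x. frechet_derivative f (at x) v)" for v
    by (intro Ck_on_cong[OF assms(1) _ assms(3)[of v]]) simp
  with assms(2) show ?thesis by (auto simp: differentiable_def)
qed

lemma Ck_on_SucD:
  assumes "Ck_on (Suc k) S f"
  shows "x \<in> S \<Longrightarrow> (f has_derivative frechet_derivative f (at x)) (at x)"
    and "Ck_on k S (\<lambda>x. frechet_derivative f (at x) v)"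
  using assms frechet_derivative_works by auto

lemma Ck_on_const: "open S \<Longrightarrow> Ck_on k S (\<lambda>x. c)"
proof (induction k arbitrary: c)
  case (Suc k)
  show ?case by (rule Ck_on_SucI[where D = "\<lambda>x v. 0"]) (use Suc in auto)
qed simp

lemma Ck_on_linear: "open S \<Longrightarrow> bounded_linear f \<Longrightarrow> Ck_on k S f"
proof (cases k)
  case (Suc k)
  assume "open S" "bounded_linear f"
  then show ?thesis unfolding Suc
    by (intro Ck_on_SucI[where D = "\<lambda>x. f"] Ck_on_const bounded_linear_imp_has_derivative)
qed (simp add: linear_continuous_on)

lemma Ck_on_compose_linear:
  assumes "open S" "bounded_linear L" "Ck_on k S f"
  shows "Ck_on k S (\<lambda>x. L (f x))"
  using assms(3)
proof (induction k arbitrary: f)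
  case 0
  then show ?case by (simp add: assms(2) bounded_linear.continuous_on)
next
  case (Suc k)
  show ?case
    by (rule Ck_on_SucI[OF assms(1), where D = "\<lambda>x v. L (frechet_derivative f (at x) v)"])
       (use Suc Ck_on_SucD[OF Suc.prems] in
         \<open>auto intro!: bounded_linear.has_derivative[OF assms(2)]\<close>)
qed

lemma Ck_on_add:
  assumes "open S" "Ck_on k S f" "Ck_on k S g"
  shows "Ck_on k S (\<lambda>x. f x + g x)"
  using assms(2,3)
proof (induction k arbitrary: f g)
  case 0
  then show ?case by (simp add: continuous_on_add)
next
  case (Suc k)
  show ?case
    by (rule Ck_on_SucI[OF assms(1), where D = "\<lambda>x v. frechet_derivative f (at x) v
         + frechet_derivative g (at x) v"])
       (use Suc Ck_on_SucD[OF Suc.prems(1)] Ck_on_SucD[OF Suc.prems(2)] in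
         \<open>auto intro!: has_derivative_add\<close>)
qed

lemma Ck_on_mult:
  fixes f g :: "'a::real_normed_vector \<Rightarrow> real"
  assumes "open S" "Ck_on k S f" "Ck_on k S g"
  shows "Ck_on k S (\<lambda>x. f x * g x)"
  using assms(2,3)
proof (induction k arbitrary: f g)
  case 0
  then show ?case by (simp add: continuous_on_mult)
next
  case (Suc k)
  note fg = Suc.prems[THEN Ck_on_Suc_imp]
  show ?case
  proof (rule Ck_on_SucI[OF assms(1)])
    show "((\<lambda>x. f x * g x) has_derivative (\<lambda>v. f x * frechet_derivative g (at x) v
         + frechet_derivative f (at x) v * g x)) (at x)" if "x \<in> S" for x
      using that by (intro has_derivative_mult Ck_on_SucD[OF Suc.prems(1)] Ck_on_SucD[OF Suc.prems(2)])
    show "Ck_on k S (\<lambda>x. f x * frechet_derivative g (at x) v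
         + frechet_derivative f (at x) v * g x)" for v
      by (intro Ck_on_add[OF assms(1)] Suc.IH fg Ck_on_SucD[OF Suc.prems(1)] Ck_on_SucD[OF Suc.prems(2)])
  qed
qed

lemma Ck_on_sum:
  assumes "open S" "\<And>i. i \<in> I \<Longrightarrow> Ck_on k S (f i)"
  shows "Ck_on k S (\<lambda>x. \<Sum>i\<in>I. f i x)"
  using assms(2)
  by (induction I rule: infinite_finite_induct)
     (auto intro!: Ck_on_const Ck_on_add assms(1))

lemma Ck_on_inverse:
  fixes f :: "'a::real_normed_vector \<Rightarrow> real"
  assumes "open S" "Ck_on k S f" "\<And>x. x \<in> S \<Longrightarrow> f x \<noteq> 0"
  shows "Ck_on k S (\<lambda>x. inverse (f x))"
  using assms(2)
proof (induction k)
  case 0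
  then show ?case using assms(3) by (auto intro!: continuous_on_inverse)
next
  case (Suc k)
  then have IH: "Ck_on k S (\<lambda>x. inverse (f x))" using Ck_on_Suc_imp by blast
  show ?case
  proof (rule Ck_on_SucI[OF assms(1)])
    show "((\<lambda>x. inverse (f x)) has_derivative (\<lambda>v. (- 1) * ((inverse (f x) *
         frechet_derivative f (at x) v) * inverse (f x)))) (at x)" if "x \<in> S" for x
      using Deriv.has_derivative_inverse[OF assms(3)[OF that] Ck_on_SucD(1)[OF Suc.prems that]] by simp
    show "Ck_on k S (\<lambda>x. (- 1) * ((inverse (f x) *
         frechet_derivative f (at x) v) * inverse (f x)))" for v
      by (intro Ck_on_mult[OF assms(1)] Ck_on_const[OF assms(1)] Ck_on_SucD[OF Suc.prems] IH)
  qed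
qed

lemma linear_eq_sum_Basis:
  fixes f :: "'a::euclidean_space \<Rightarrow> real"
  assumes "linear f"
  shows "f v = (\<Sum>b\<in>Basis. (v \<bullet> b) * f b)"
  by (subst euclidean_representation[symmetric, of v])
     (simp only: linear_sum[OF assms] linear_cmul[OF assms] real_scaleR_def)

lemma Ck_on_compose:
  fixes f :: "'b::euclidean_space \<Rightarrow> real" and g :: "'a::real_normed_vector \<Rightarrow> 'b"
  assumes "open S" "open T" "g ` S \<subseteq> T" "Ck_on k S g" "Ck_on k T f"
  shows "Ck_on k S (\<lambda>x. f (g x))"
  using assms(4,5)
proof (induction k arbitrary: f)
  case 0
  then show ?case using assms(3) by (auto intro: continuous_on_compose2)
next
  case (Suc k)
  note g = Ck_on_SucD[OF Suc.prems(1)] and f = Ck_on_SucD[OF Suc.prems(2)]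
  \<comment> \<open>Expanding in the basis turns the chain rule into sums of products, to which the
    induction hypothesis applies.\<close>
  have eq: "frechet_derivative f (at (g x)) (frechet_derivative g (at x) v) =
     (\<Sum>b\<in>Basis. (frechet_derivative g (at x) v \<bullet> b) * frechet_derivative f (at (g x)) b)"
    if "x \<in> S" for x v
  proof -
    have "linear (frechet_derivative f (at (g x)))"
      using f(1)[of "g x"] that assms(3) has_derivative_linear by blast
    then show ?thesis by (rule linear_eq_sum_Basis)
  qed
  have "Ck_on k S (\<lambda>x. \<Sum>b\<in>Basis. (frechet_derivative g (at x) v \<bullet> b) *
       frechet_derivative f (at (g x)) b)" for v
    by (intro Ck_on_sum[OF assms(1)] Ck_on_mult[OF assms(1)]
         Ck_on_compose_linear[OF assms(1) bounded_linear_inner_left] g Suc.IH f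
         Ck_on_Suc_imp[OF Suc.prems(1)])
  moreover have "((\<lambda>x. f (g x)) has_derivative (\<lambda>v. \<Sum>b\<in>Basis. (frechet_derivative g (at x) v \<bullet> b)
       * frechet_derivative f (at (g x)) b)) (at x)" if "x \<in> S" for x
    using diff_chain_at[OF g(1)[OF that] f(1)[of "g x"]] assms(3) that eq[OF that]
    by (auto simp: o_def)
  ultimately show ?case
    by (intro Ck_on_SucI[OF assms(1)])
qed

lemma smooth_on_cong:
  "open S \<Longrightarrow> (\<And>x. x \<in> S \<Longrightarrow> f x = g x) \<Longrightarrow> smooth_on S f \<Longrightarrow> smooth_on S g"
  unfolding smooth_on_def using Ck_on_cong by blast

lemma smooth_on_subset: "smooth_on T f \<Longrightarrow> S \<subseteq> T \<Longrightarrow> smooth_on S f"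
  unfolding smooth_on_def using Ck_on_subset by blast

lemma smooth_on_local:
  assumes "\<And>x. x \<in> S \<Longrightarrow> \<exists>T. open T \<and> x \<in> T \<and> smooth_on T f"
  shows "smooth_on S f"
  unfolding smooth_on_def using assms by (meson Ck_on_local smooth_on_def)

lemma smooth_on_const: "open S \<Longrightarrow> smooth_on S (\<lambda>x. c)"
  by (simp add: smooth_on_def Ck_on_const)

lemma smooth_on_linear: "open S \<Longrightarrow> bounded_linear f \<Longrightarrow> smooth_on S f"
  by (simp add: smooth_on_def Ck_on_linear)

lemma smooth_on_add:
  "open S \<Longrightarrow> smooth_on S f \<Longrightarrow> smooth_on S g \<Longrightarrow> smooth_on S (\<lambda>x. f x + g x)"
  by (simp add: smooth_on_def Ck_on_add)

lemma smooth_on_mult: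
  fixes f g :: "'a::real_normed_vector \<Rightarrow> real"
  shows "open S \<Longrightarrow> smooth_on S f \<Longrightarrow> smooth_on S g \<Longrightarrow> smooth_on S (\<lambda>x. f x * g x)"
  by (simp add: smooth_on_def Ck_on_mult)

lemma smooth_on_inverse:
  fixes f :: "'a::real_normed_vector \<Rightarrow> real"
  shows "open S \<Longrightarrow> smooth_on S f \<Longrightarrow> (\<And>x. x \<in> S \<Longrightarrow> f x \<noteq> 0) \<Longrightarrow>
    smooth_on S (\<lambda>x. inverse (f x))"
  by (simp add: smooth_on_def Ck_on_inverse)

lemma smooth_on_sum:
  "open S \<Longrightarrow> (\<And>i. i \<in> I \<Longrightarrow> smooth_on S (f i)) \<Longrightarrow> smooth_on S (\<lambda>x. \<Sum>i\<in>I. f i x)"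
  by (simp add: smooth_on_def Ck_on_sum)

lemma smooth_on_compose:
  fixes f :: "'b::euclidean_space \<Rightarrow> real" and g :: "'a::real_normed_vector \<Rightarrow> 'b"
  shows "open S \<Longrightarrow> open T \<Longrightarrow> g ` S \<subseteq> T \<Longrightarrow> smooth_on S g \<Longrightarrow> smooth_on T f \<Longrightarrow>
    smooth_on S (\<lambda>x. f (g x))"
  unfolding smooth_on_def using Ck_on_compose by blast

lemma smooth_on_imp_has_derivative:
  "smooth_on S f \<Longrightarrow> x \<in> S \<Longrightarrow> (f has_derivative frechet_derivative f (at x)) (at x)"
  by (rule Ck_on_SucD(1)[of 0 S]) (simp_all only: smooth_on_def)

lemma smooth_on_frechet_derivative:
  "smooth_on S f \<Longrightarrow> smooth_on S (\<lambda>x. frechet_derivative f (at x) v)"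
  unfolding smooth_on_def using Ck_on_SucD(2) by blast

lemma smooth_on_imp_continuous_on: "smooth_on S f \<Longrightarrow> continuous_on S f"
  unfolding smooth_on_def using Ck_on.simps(1) by blast

section \<open>Bump functions\<close>

text \<open>
  The classical function \<open>exp (- 1 / t)\<close> extended by zero. The factor \<open>(1 / t) ^ n\<close> makes the family
  closed, up to linear combinations, under differentiation, so that all derivatives are treated by
  one induction.
\<close>

definition flat_exp :: "nat \<Rightarrow> real \<Rightarrow> real" where
  "flat_exp n t = (if t > 0 then inverse t ^ n * exp (- inverse t) else 0)"

lemma flat_exp_tendsto_0: "((\<lambda>t. inverse t ^ n * exp (- inverse t)) \<longlongrightarrow> (0::real)) (at_right 0)"
proof -
  have "((\<lambda>x::real. x ^ n / exp x) \<longlongrightarrow> 0) at_top"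
    by (rule tendsto_power_div_exp_0)
  then have "((\<lambda>t::real. inverse t ^ n / exp (inverse t)) \<longlongrightarrow> 0) (at_right 0)"
    by (rule filterlim_compose) (rule filterlim_inverse_at_top_right)
  then show ?thesis by (simp add: exp_minus field_simps)
qed

lemma flat_exp_deriv:
  "(flat_exp n has_field_derivative (flat_exp (n + 2) t - real n * flat_exp (n + 1) t)) (at t)"
proof (cases t "0::real" rule: linorder_cases)
  case less
  have "((\<lambda>t. 0) has_field_derivative (flat_exp (n + 2) t - real n * flat_exp (n + 1) t)) (at t)"
    using less by (simp add: flat_exp_def)
  then show ?thesis
    by (rule has_field_derivative_transform_within_open[where S = "{..<0}"])
       (use less in \<open>auto simp: flat_exp_def\<close>)
next
  case greater
  have "((\<lambda>t. inverse t ^ n * exp (- inverse t)) has_field_derivative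
      (flat_exp (n + 2) t - real n * flat_exp (n + 1) t)) (at t)"
    using greater
    by (cases n) (auto intro!: derivative_eq_intros
         simp: flat_exp_def field_simps power2_eq_square, metis Suc_pred gr0I power_Suc)
  then show ?thesis
    by (rule has_field_derivative_transform_within_open[where S = "{0<..}"])
       (use greater in \<open>auto simp: flat_exp_def\<close>)
next
  case equal
  have "((\<lambda>h. flat_exp n h / h) \<longlongrightarrow> 0) (at_right 0)"
  proof (rule Lim_transform_eventually[OF flat_exp_tendsto_0[of "Suc n"]])
    show "\<forall>\<^sub>F h in at_right 0. inverse h ^ Suc n * exp (- inverse h) = flat_exp n h / h"
      by (auto simp: eventually_at_filter flat_exp_def field_simps)
  qed
  moreover have "((\<lambda>h. flat_exp n h / h) \<longlongrightarrow> 0) (at_left 0)"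
    by (rule Lim_transform_eventually[OF tendsto_const])
       (auto simp: eventually_at_filter flat_exp_def)
  ultimately have "((\<lambda>h. flat_exp n h / h) \<longlongrightarrow> 0) (at 0)"
    by (simp add: filterlim_split_at)
  then show ?thesis using equal by (simp add: DERIV_def flat_exp_def)
qed

lemma Ck_on_flat_exp: "Ck_on k UNIV (flat_exp n)"
proof (induction k arbitrary: n)
  case 0
  then show ?case using flat_exp_deriv[of n]
    by (auto simp: continuous_on_eq_continuous_at intro: DERIV_isCont)
next
  case (Suc k)
  show ?case
  proof (rule Ck_on_SucI)
    show "(flat_exp n has_derivative (\<lambda>v. (flat_exp (n + 2) t + (- real n) * flat_exp (n + 1) t) * v)) (at t)"
      for t
      using flat_exp_deriv[of n t] by (simp add: has_field_derivative_def)
    show "Ck_on k UNIV (\<lambda>t. (flat_exp (n + 2) t + (- real n) * flat_exp (n + 1) t) * v)" for v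
      by (intro Ck_on_mult Ck_on_add Ck_on_const Suc.IH) auto
  qed simp
qed

text \<open>
  With \<open>\<theta> = flat_exp 0\<close> and \<open>d\<close> the squared distance from \<open>x\<close>, the quotient
  \<open>\<theta>(s\<^sup>2 - d) / (\<theta>(s\<^sup>2 - d) + \<theta>(d - r\<^sup>2))\<close> works: its denominator never vanishes as \<open>r < s\<close>.
\<close>

lemma smooth_bump:
  fixes x :: "'a::euclidean_space"
  assumes "0 < r" "r < s"
  shows "\<exists>\<beta> :: 'a \<Rightarrow> real. smooth_on UNIV \<beta> \<and> (\<forall>y. dist x y \<le> r \<longrightarrow> \<beta> y = 1) \<and>
    (\<forall>y. dist x y \<ge> s \<longrightarrow> \<beta> y = 0)"
proof -
  let ?d = "\<lambda>y. (y - x) \<bullet> (y - x)"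
  let ?f = "\<lambda>y. flat_exp 0 (s\<^sup>2 + (-1) * ?d y)" and ?g = "\<lambda>y. flat_exp 0 (?d y + (- (r\<^sup>2)))"
  define \<beta> where "\<beta> = (\<lambda>y. ?f y * inverse (?f y + ?g y))"
  have rs: "r\<^sup>2 < s\<^sup>2" using assms by (simp add: power_strict_mono)
  have d: "?d y = (dist x y)\<^sup>2" for y
    by (simp add: dist_norm power2_norm_eq_inner inner_diff inner_commute)
  have nz: "?f y + ?g y \<noteq> 0" for y
    using rs by (auto simp: flat_exp_def) (smt (verit) exp_gt_zero)
  have sd: "smooth_on UNIV ?d"
  proof -
    have "smooth_on UNIV (\<lambda>y. \<Sum>b\<in>Basis. (y \<bullet> b + (- (x \<bullet> b))) * (y \<bullet> b + (- (x \<bullet> b))))"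
      by (intro smooth_on_sum smooth_on_mult smooth_on_add smooth_on_const smooth_on_linear
          bounded_linear_inner_left open_UNIV)
    then show ?thesis
      by (subst euclidean_inner) (simp add: inner_diff_left)
  qed
  have fl: "smooth_on UNIV (flat_exp 0)" by (simp add: smooth_on_def Ck_on_flat_exp)
  have sf: "smooth_on UNIV ?f"
    by (rule smooth_on_compose[OF _ _ _ _ fl])
       (intro smooth_on_add smooth_on_mult smooth_on_const sd open_UNIV subset_UNIV)+
  have sg: "smooth_on UNIV ?g"
    by (rule smooth_on_compose[OF _ _ _ _ fl])
       (intro smooth_on_add smooth_on_const sd open_UNIV subset_UNIV)+
  have "smooth_on UNIV \<beta>"
    unfolding \<beta>_def by (intro smooth_on_mult smooth_on_inverse smooth_on_add sf sg nz) auto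
  moreover have "\<beta> y = 1" if "dist x y \<le> r" for y
  proof -
    have "(dist x y)\<^sup>2 \<le> r\<^sup>2" using that by (simp add: power_mono)
    then show ?thesis using rs nz[of y] by (simp add: \<beta>_def d flat_exp_def)
  qed
  moreover have "\<beta> y = 0" if "dist x y \<ge> s" for y
  proof -
    have "s\<^sup>2 \<le> (dist x y)\<^sup>2" using that assms by (simp add: power_mono)
    then show ?thesis by (simp add: \<beta>_def d flat_exp_def)
  qed
  ultimately show ?thesis by blast
qed

section \<open>Hadamard's lemma\<close>

lemma convex_segment_mem:
  fixes a x :: "'a::real_vector" and t :: real
  assumes "convex B" "a \<in> B" "x \<in> B" "t \<in> {0..1}"
  shows "a + t *\<^sub>R (x - a) \<in> B"
proof -
  have "(1 - t) *\<^sub>R a + t *\<^sub>R x \<in> B" using assms by (intro convexD_alt) auto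
  then show ?thesis by (simp add: algebra_simps)
qed

text \<open>
  Differentiating under the integral sign in direction \<open>v\<close> produces an integral of the same form, with
  the weight \<open>w t\<close> replaced by \<open>w t * t\<close> and \<open>F\<close> by its directional derivative. An arbitrary weight is
  therefore what the induction on \<open>k\<close> requires.
\<close>

lemma Ck_on_integral:
  fixes F :: "'a::euclidean_space \<Rightarrow> real"
  assumes B: "open B" "convex B" "a \<in> B" and w: "continuous_on {0..1} w" and F: "smooth_on B F"
  shows "Ck_on k B (\<lambda>x. integral {0..1} (\<lambda>t. w t * F (a + t *\<^sub>R (x - a))))"
  using w F
proof (induction k arbitrary: w F)
  have seg: "a + t *\<^sub>R (x - a) \<in> B" if "x \<in> B" "t \<in> {0..1}" for x and t :: real
    by (rule convex_segment_mem[OF B(2,3) that])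
  have cont: "continuous_on (B \<times> {0..1}) (\<lambda>(x, t). w t * F (a + t *\<^sub>R (x - a)))"
    if w: "continuous_on {0..1} w" and F: "continuous_on B F" for w and F :: "'a \<Rightarrow> real"
    unfolding split_beta
    by (intro continuous_on_mult continuous_on_compose2[OF w] continuous_on_compose2[OF F]
        continuous_intros) (auto simp: seg)
  {
    case 0
    have "continuous_on (B \<times> cbox 0 1) (\<lambda>(x, t::real). w t * F (a + t *\<^sub>R (x - a)))"
      using cont[OF 0(1) smooth_on_imp_continuous_on[OF 0(2)]] by simp
    from integral_continuous_on_param[OF this] show ?case by simp
  next
    case (Suc k)
    \<comment> \<open>The derivative of the integrand, written as a bounded linear map whose dependence on
      \<open>x\<close> and \<open>t\<close> is visibly continuous.\<close>
    let ?D = "\<lambda>x t. \<Sum>b\<in>Basis. (w t * t * frechet_derivative F (at (a + t *\<^sub>R (x - a))) b)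
       *\<^sub>R blinfun_inner_left b"
    have contD: "continuous_on (B \<times> {0..1})
       (\<lambda>(x, t). w t * t * frechet_derivative F (at (a + t *\<^sub>R (x - a))) b)" for b
    proof -
      have "continuous_on {0..1} (\<lambda>t. w t * t)"
        by (intro continuous_intros Suc.prems(1))
      from cont[OF this smooth_on_imp_continuous_on[OF smooth_on_frechet_derivative[OF Suc.prems(2)]]]
      show ?thesis .
    qed
    have dF: "(F has_derivative frechet_derivative F (at (a + t *\<^sub>R (x - a))))
        (at (a + t *\<^sub>R (x - a)))" if "x \<in> B" "t \<in> cbox 0 1" for x and t :: real
      by (rule smooth_on_imp_has_derivative[OF Suc.prems(2)]) (use seg that in auto)
    have Dv: "?D x t v = w t * t * frechet_derivative F (at (a + t *\<^sub>R (x - a))) v"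
      if "x \<in> B" "t \<in> cbox 0 1" for x t v
    proof -
      have lin: "linear (frechet_derivative F (at (a + t *\<^sub>R (x - a))))"
        using dF[OF that] has_derivative_linear by blast
      then have "frechet_derivative F (at (a + t *\<^sub>R (x - a))) v =
          (\<Sum>b\<in>Basis. (v \<bullet> b) * frechet_derivative F (at (a + t *\<^sub>R (x - a))) b)"
        by (rule linear_eq_sum_Basis)
      then show ?thesis
        by (simp add: blinfun.sum_left blinfun.scaleR_left sum_distrib_left mult_ac)
    qed
    have contI: "continuous_on (B \<times> cbox 0 1) (\<lambda>(x, t). ?D x t)"
      unfolding split_beta
      by (intro continuous_on_sum continuous_on_scaleR continuous_on_const
            contD[unfolded split_beta, folded cbox_interval])
    have "((\<lambda>x. integral (cbox 0 1) (\<lambda>t. w t * F (a + t *\<^sub>R (x - a)))) has_derivative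
        integral (cbox 0 1) (?D x)) (at x within B)" if x: "x \<in> B" for x
    proof (rule leibniz_rule[OF _ _ _ x B(2)])
      fix x and t :: real assume xt: "x \<in> B" "t \<in> cbox 0 1"
      let ?y = "a + t *\<^sub>R (x - a)"
      note dF = dF[OF xt]
      have "((\<lambda>x. a + t *\<^sub>R (x - a)) has_derivative (\<lambda>v. t *\<^sub>R v)) (at x within B)"
        by (auto intro!: derivative_eq_intros)
      from has_derivative_compose[OF this dF]
      have "((\<lambda>x. w t * F (a + t *\<^sub>R (x - a))) has_derivative
           (\<lambda>v. w t * frechet_derivative F (at ?y) (t *\<^sub>R v))) (at x within B)"
        by (rule has_derivative_mult_right)
      then show "((\<lambda>x. w t * F (a + t *\<^sub>R (x - a))) has_derivative blinfun_apply (?D x t))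
           (at x within B)"
      proof (rule has_derivative_eq_rhs, intro ext)
        show "w t * frechet_derivative F (at ?y) (t *\<^sub>R v) = ?D x t v" for v
          using Dv[OF xt] has_derivative_linear[OF dF] by (simp add: linear_cmul)
      qed
    next
      fix x assume "x \<in> B"
      then have "continuous_on {0..1} (\<lambda>t. w t * F (a + t *\<^sub>R (x - a)))"
        by (intro continuous_on_mult Suc.prems(1)
            continuous_on_compose2[OF smooth_on_imp_continuous_on[OF Suc.prems(2)]]
            continuous_intros) (auto simp: seg)
      then show "(\<lambda>t. w t * F (a + t *\<^sub>R (x - a))) integrable_on cbox 0 1"
        by (simp add: integrable_continuous_real)
    next
      show "continuous_on (B \<times> cbox 0 1) (\<lambda>(x, t). ?D x t)" by (rule contI)
    qed
    then have der: "((\<lambda>x. integral {0..1} (\<lambda>t. w t * F (a + t *\<^sub>R (x - a)))) has_derivative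
        integral (cbox 0 1) (?D x)) (at x)" if "x \<in> B" for x
      using that by (simp add: at_within_open[OF _ B(1)])
    have appl: "integral (cbox 0 1) (?D x) v = integral {0..1}
       (\<lambda>t. (w t * t) * (frechet_derivative F (at (a + t *\<^sub>R (x - a))) v))" if x: "x \<in> B" for x v
    proof -
      have "continuous_on (cbox 0 1) (\<lambda>t. (\<lambda>(x, t). ?D x t) (x, t))"
        by (rule continuous_on_compose2[OF contI]) (use x in \<open>auto intro!: continuous_intros\<close>)
      then have "continuous_on (cbox 0 1) (?D x)" by simp
      then have "integral (cbox 0 1) (?D x) v = integral (cbox 0 1) (\<lambda>t. ?D x t v)"
        by (intro blinfun_apply_integral integrable_continuous)
      also have "\<dots> = integral {0..1}
          (\<lambda>t. (w t * t) * (frechet_derivative F (at (a + t *\<^sub>R (x - a))) v))"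
        unfolding cbox_interval using Dv[OF x] by (intro integral_cong) auto
      finally show ?thesis .
    qed
    show ?case
    proof (rule Ck_on_SucI[OF B(1) der])
      have "Ck_on k B (\<lambda>x. integral {0..1}
         (\<lambda>t. (w t * t) * (frechet_derivative F (at (a + t *\<^sub>R (x - a))) v)))" for v
        by (rule Suc.IH) (auto intro!: continuous_intros Suc.prems smooth_on_frechet_derivative)
      from Ck_on_cong[OF B(1) appl[symmetric] this]
      show "Ck_on k B (\<lambda>x. integral (cbox 0 1) (?D x) v)" for v .
    qed
  }
qed

text \<open>
  Integrate the derivative of \<open>t \<mapsto> F (a + t (x - a))\<close> over \<open>[0, 1]\<close>; the coefficients are the
  integrals of the partial derivatives along the segment.
\<close>

lemma Hadamard:
  fixes F :: "'a::euclidean_space \<Rightarrow> real"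
  assumes B: "open B" "convex B" "a \<in> B" and F: "smooth_on B F"
  obtains G where "\<And>b. smooth_on B (G b)"
    "\<And>x. x \<in> B \<Longrightarrow> F x = F a + (\<Sum>b\<in>Basis. ((x - a) \<bullet> b) * G b x)"
    "\<And>b. G b a = frechet_derivative F (at a) b"
proof -
  define G where "G = (\<lambda>b x. integral {0..1} (\<lambda>t. 1 * frechet_derivative F (at (a + t *\<^sub>R (x - a))) b))"
  have "smooth_on B (G b)" for b
    unfolding smooth_on_def G_def
    by (intro allI Ck_on_integral B smooth_on_frechet_derivative[OF F]) simp
  moreover have "F x = F a + (\<Sum>b\<in>Basis. ((x - a) \<bullet> b) * G b x)" if x: "x \<in> B" for x
  proof -
    have seg: "a + t *\<^sub>R (x - a) \<in> B" if "t \<in> {0..1}" for t :: real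
      by (rule convex_segment_mem[OF B(2,3) x that])
    let ?D = "\<lambda>t. frechet_derivative F (at (a + t *\<^sub>R (x - a)))"
    have D: "(F has_derivative ?D t) (at (a + t *\<^sub>R (x - a)))" if "t \<in> {0..1}" for t
      by (rule smooth_on_imp_has_derivative[OF F seg[OF that]])
    have "((\<lambda>t. F (a + t *\<^sub>R (x - a))) has_vector_derivative ?D t (x - a)) (at t within {0..1})"
      if "t \<in> {0..1}" for t
    proof -
      have "((\<lambda>t. a + t *\<^sub>R (x - a)) has_derivative (\<lambda>s. s *\<^sub>R (x - a))) (at t within {0..1})"
        by (auto intro!: derivative_eq_intros)
      from has_derivative_compose[OF this D[OF that]]
      show ?thesis using has_derivative_linear[OF D[OF that]]
        by (simp add: has_vector_derivative_def linear_cmul)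
    qed
    then have "((\<lambda>t. ?D t (x - a)) has_integral F (a + 1 *\<^sub>R (x - a)) - F (a + 0 *\<^sub>R (x - a))) {0..1}"
      by (intro fundamental_theorem_of_calculus) auto
    then have "F x - F a = integral {0..1} (\<lambda>t. ?D t (x - a))"
      by (simp add: integral_unique)
    also have "\<dots> = integral {0..1} (\<lambda>t. \<Sum>b\<in>Basis. ((x - a) \<bullet> b) * ?D t b)"
    proof (rule integral_cong)
      fix t :: real assume "t \<in> {0..1}"
      then have "linear (?D t)" using D has_derivative_linear by blast
      then show "?D t (x - a) = (\<Sum>b\<in>Basis. ((x - a) \<bullet> b) * ?D t b)"
        by (rule linear_eq_sum_Basis)
    qed
    also have "\<dots> = (\<Sum>b\<in>Basis. integral {0..1} (\<lambda>t. ((x - a) \<bullet> b) * ?D t b))"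
    proof (rule integral_sum)
      fix b :: 'a
      have "continuous_on {0..1} (\<lambda>t. ?D t b)"
        by (rule continuous_on_compose2[OF smooth_on_imp_continuous_on[OF
              smooth_on_frechet_derivative[OF F]]])
           (use seg in \<open>auto intro!: continuous_intros\<close>)
      then show "(\<lambda>t. ((x - a) \<bullet> b) * ?D t b) integrable_on {0..1}"
        by (intro integrable_continuous_real continuous_on_mult continuous_on_const)
    qed simp
    finally show ?thesis by (simp add: G_def)
  qed
  moreover have "G b a = frechet_derivative F (at a) b" for b
    by (simp add: G_def)
  ultimately show ?thesis by (rule that)
qed

section \<open>Smooth functions on a manifold\<close>

text \<open>
  Smoothness on an open subset is needed because inverses and solutions of linear systems are smooth
  only near a given point.
\<close>

definition smooth_fun_on ::
  "('m, 'e::euclidean_space) chart set \<Rightarrow> 'm set \<Rightarrow> ('m \<Rightarrow> real) \<Rightarrow> bool" where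
  "smooth_fun_on A N f \<longleftrightarrow> (\<forall>(U, \<phi>)\<in>A. smooth_on (\<phi> ` (U \<inter> N)) (f \<circ> inv_into U \<phi>))"

lemma smooth_fun_on_UNIV: "smooth_fun_on A UNIV f \<longleftrightarrow> smooth_fun A f"
  by (simp add: smooth_fun_on_def smooth_fun_def)

locale smooth_manifold =
  fixes A :: "('m::{t2_space, second_countable_topology}, 'e::euclidean_space) chart set"
  assumes atlas: "smooth_atlas A"
begin

lemma chart:
  assumes "(U, \<phi>) \<in> A"
  shows "open U" "open (\<phi> ` U)" "continuous_on U \<phi>" "continuous_on (\<phi> ` U) (inv_into U \<phi>)"
    "\<And>q. q \<in> U \<Longrightarrow> inv_into U \<phi> (\<phi> q) = q"
  using atlas assms unfolding smooth_atlas_def homeomorphism_def by fastforce+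

lemma chart_at: obtains U \<phi> where "(U, \<phi>) \<in> A" "p \<in> U"
proof -
  have "p \<in> (\<Union>(U, \<phi>)\<in>A. U)" using atlas unfolding smooth_atlas_def by simp
  then show ?thesis using that by auto
qed

lemma transition_smooth:
  "(U, \<phi>) \<in> A \<Longrightarrow> (V, \<psi>) \<in> A \<Longrightarrow> smooth_on (\<phi> ` (U \<inter> V)) (\<psi> \<circ> inv_into U \<phi>)"
  using atlas unfolding smooth_atlas_def by fastforce

lemma chart_image_open:
  assumes "(U, \<phi>) \<in> A" "open N"
  shows "open (\<phi> ` (U \<inter> N))"
proof -
  have "\<phi> ` (U \<inter> N) = \<phi> ` U \<inter> inv_into U \<phi> -` N"
    using chart(5)[OF assms(1)] by auto
  then show ?thesis
    using continuous_open_preimage[OF chart(4,2)[OF assms(1)] assms(2)] by simp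
qed

lemma smooth_fun_on_subset: "smooth_fun_on A N f \<Longrightarrow> N' \<subseteq> N \<Longrightarrow> smooth_fun_on A N' f"
  unfolding smooth_fun_on_def by (fastforce intro: smooth_on_subset)

lemma smooth_fun_imp_on: "smooth_fun A f \<Longrightarrow> smooth_fun_on A N f"
  using smooth_fun_on_subset[of UNIV f N] by (simp add: smooth_fun_on_UNIV)

lemma smooth_fun_on_cong:
  assumes "open N" "\<And>q. q \<in> N \<Longrightarrow> f q = g q" "smooth_fun_on A N f"
  shows "smooth_fun_on A N g"
  unfolding smooth_fun_on_def
proof clarify
  fix U \<phi> assume U: "(U, \<phi>) \<in> A"
  show "smooth_on (\<phi> ` (U \<inter> N)) (g \<circ> inv_into U \<phi>)"
    by (rule smooth_on_cong[OF chart_image_open[OF U assms(1)], of "f \<circ> inv_into U \<phi>"])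
       (use assms(2,3) U chart(5)[OF U] in \<open>auto simp: smooth_fun_on_def\<close>)
qed

lemma smooth_fun_local:
  assumes "\<And>p. \<exists>N. open N \<and> p \<in> N \<and> smooth_fun_on A N f"
  shows "smooth_fun A f"
  unfolding smooth_fun_def
proof clarify
  fix U \<phi> assume U: "(U, \<phi>) \<in> A"
  show "smooth_on (\<phi> ` U) (f \<circ> inv_into U \<phi>)"
  proof (rule smooth_on_local)
    fix x assume "x \<in> \<phi> ` U"
    then obtain p where p: "p \<in> U" "x = \<phi> p" by auto
    obtain N where N: "open N" "p \<in> N" "smooth_fun_on A N f" using assms by blast
    show "\<exists>T. open T \<and> x \<in> T \<and> smooth_on T (f \<circ> inv_into U \<phi>)"
      by (rule exI[of _ "\<phi> ` (U \<inter> N)"])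
         (use N U p chart_image_open[OF U N(1)] in \<open>auto simp: smooth_fun_on_def\<close>)
  qed
qed

lemma smooth_fun_on_const: "open N \<Longrightarrow> smooth_fun_on A N (\<lambda>q. c)"
  unfolding smooth_fun_on_def by (auto simp: o_def intro!: smooth_on_const chart_image_open)

lemma smooth_fun_on_add:
  "open N \<Longrightarrow> smooth_fun_on A N f \<Longrightarrow> smooth_fun_on A N g \<Longrightarrow> smooth_fun_on A N (\<lambda>q. f q + g q)"
  unfolding smooth_fun_on_def o_def by (fastforce intro!: smooth_on_add chart_image_open)

lemma smooth_fun_on_mult:
  "open N \<Longrightarrow> smooth_fun_on A N f \<Longrightarrow> smooth_fun_on A N g \<Longrightarrow> smooth_fun_on A N (\<lambda>q. f q * g q)"
  unfolding smooth_fun_on_def o_def by (fastforce intro!: smooth_on_mult chart_image_open)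

lemma smooth_fun_on_inverse:
  "open N \<Longrightarrow> smooth_fun_on A N f \<Longrightarrow> (\<And>q. q \<in> N \<Longrightarrow> f q \<noteq> 0) \<Longrightarrow>
    smooth_fun_on A N (\<lambda>q. inverse (f q))"
  unfolding smooth_fun_on_def o_def
  by (auto intro!: smooth_on_inverse chart_image_open simp: chart(5))

lemma smooth_fun_on_diff:
  assumes "open N" "smooth_fun_on A N f" "smooth_fun_on A N g"
  shows "smooth_fun_on A N (\<lambda>q. f q - g q)"
  using smooth_fun_on_add[OF assms(1,2) smooth_fun_on_mult[OF assms(1)
        smooth_fun_on_const[OF assms(1), of "-1"] assms(3)]] by simp

lemma smooth_fun_on_sum:
  "open N \<Longrightarrow> (\<And>i. i \<in> I \<Longrightarrow> smooth_fun_on A N (f i)) \<Longrightarrow> smooth_fun_on A N (\<lambda>q. \<Sum>i\<in>I. f i q)"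
  by (induction I rule: infinite_finite_induct)
     (auto intro!: smooth_fun_on_const smooth_fun_on_add)

lemmas smooth_fun_const = smooth_fun_on_const[OF open_UNIV, unfolded smooth_fun_on_UNIV]
lemmas smooth_fun_add = smooth_fun_on_add[OF open_UNIV, unfolded smooth_fun_on_UNIV]
lemmas smooth_fun_mult = smooth_fun_on_mult[OF open_UNIV, unfolded smooth_fun_on_UNIV]
lemmas smooth_fun_diff = smooth_fun_on_diff[OF open_UNIV, unfolded smooth_fun_on_UNIV]
lemmas smooth_fun_sum = smooth_fun_on_sum[OF open_UNIV, unfolded smooth_fun_on_UNIV]
lemmas smooth_fun_intros = smooth_fun_const smooth_fun_add smooth_fun_mult smooth_fun_diff
  smooth_fun_sum

lemma smooth_fun_on_imp_continuous_on:
  assumes "open N" "smooth_fun_on A N f"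
  shows "continuous_on N f"
proof (rule continuous_at_imp_continuous_on, rule ballI)
  fix p assume p: "p \<in> N"
  obtain U \<phi> where U: "(U, \<phi>) \<in> A" "p \<in> U" by (rule chart_at)
  have "continuous_on (\<phi> ` (U \<inter> N)) (f \<circ> inv_into U \<phi>)"
    using assms(2) U(1) smooth_on_imp_continuous_on unfolding smooth_fun_on_def by blast
  then have "continuous_on (U \<inter> N) (\<lambda>q. (f \<circ> inv_into U \<phi>) (\<phi> q))"
    by (rule continuous_on_compose2) (auto intro: continuous_on_subset[OF chart(3)[OF U(1)]])
  then have "continuous_on (U \<inter> N) f"
    by (rule continuous_on_cong[THEN iffD1, rotated 2]) (auto simp: chart(5)[OF U(1)])
  then show "isCont f p"
    using p U chart(1)[OF U(1)] assms(1) by (simp add: continuous_on_eq_continuous_at open_Int)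
qed

text \<open>
  The compact set \<open>K\<close> pulls back to a compact, hence (by the Hausdorff property) closed subset of the
  manifold. The extended function is zero on the open complement of that set and smooth on \<open>U\<close>, and
  these two open sets cover the manifold.
\<close>

lemma smooth_fun_extend_by_zero:
  assumes U: "(U, \<phi>) \<in> A" and G: "smooth_on (\<phi> ` U) G"
    and K: "compact K" "K \<subseteq> \<phi> ` U" "\<And>x. x \<in> \<phi> ` U \<Longrightarrow> x \<notin> K \<Longrightarrow> G x = 0"
  shows "smooth_fun A (\<lambda>q. if q \<in> U then G (\<phi> q) else 0)" (is "smooth_fun A ?f")
proof (rule smooth_fun_local)
  fix p
  show "\<exists>N. open N \<and> p \<in> N \<and> smooth_fun_on A N ?f"
  proof (cases "p \<in> U")
    case True
    have "smooth_fun_on A U ?f"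
      unfolding smooth_fun_on_def
    proof clarify
      fix V \<psi> assume V: "(V, \<psi>) \<in> A"
      have o: "open (\<psi> ` (V \<inter> U))" using chart_image_open[OF V chart(1)[OF U]] .
      have "smooth_on (\<psi> ` (V \<inter> U)) (\<lambda>x. G ((\<phi> \<circ> inv_into V \<psi>) x))"
        by (rule smooth_on_compose[OF o chart(2)[OF U] _ transition_smooth[OF V U] G])
           (auto simp: chart(5)[OF V])
      then show "smooth_on (\<psi> ` (V \<inter> U)) (?f \<circ> inv_into V \<psi>)"
        by (rule smooth_on_cong[OF o, rotated]) (auto simp: chart(5)[OF V])
    qed
    then show ?thesis using True chart(1)[OF U] by blast
  next
    case False
    let ?K = "inv_into U \<phi> ` K"
    have "compact ?K"
      using K(1,2) chart(4)[OF U] by (meson compact_continuous_image continuous_on_subset)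
    then have op: "open (- ?K)" by (simp add: compact_imp_closed open_Compl)
    have "?K \<subseteq> U" using K(2) chart(5)[OF U] by auto
    then have p: "p \<in> - ?K" using False by auto
    have "?f q = 0" if "q \<notin> ?K" for q
    proof (cases "q \<in> U")
      case True
      then have "\<phi> q \<notin> K" using that chart(5)[OF U True] by (metis image_eqI)
      then show ?thesis using K(3) True by auto
    qed simp
    then have "smooth_fun_on A (- ?K) ?f"
      by (intro smooth_fun_on_cong[OF op _ smooth_fun_on_const[OF op, of 0]]) (metis ComplD)
    then show ?thesis using p op by blast
  qed
qed

section \<open>Linear systems with smooth coefficients\<close>

text \<open>
  A pointwise solution \<open>W\<close> of a smooth system is smooth near \<open>p\<close>: it can be computed by Gaussian
  elimination, one unknown at a time. As the columns are independent at \<open>p\<close>, column \<open>j\<close> has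
  an entry that is nonzero at \<open>p\<close>, hence near \<open>p\<close>, and can serve as pivot. The set of rows is kept
  fixed, the pivot row becoming zero after elimination, so that the induction runs over the columns
  alone and independence at \<open>p\<close> is passed on to the remaining ones.
\<close>

lemma smooth_fun_on_solution:
  assumes "finite J" "open N" "p \<in> N"
    and "\<And>i j. i \<in> I \<Longrightarrow> j \<in> J \<Longrightarrow> smooth_fun_on A N (H i j)"
    and "\<And>i. i \<in> I \<Longrightarrow> smooth_fun_on A N (\<omega> i)"
    and "\<And>i q. i \<in> I \<Longrightarrow> q \<in> N \<Longrightarrow> (\<Sum>j\<in>J. H i j q * W j q) = \<omega> i q"
    and "\<And>c j. (\<And>i. i \<in> I \<Longrightarrow> (\<Sum>j\<in>J. H i j p * c j) = 0) \<Longrightarrow> j \<in> J \<Longrightarrow> c j = 0"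
  shows "\<exists>N'. open N' \<and> p \<in> N' \<and> (\<forall>j\<in>J. smooth_fun_on A N' (W j))"
  using assms
proof (induction J arbitrary: N H \<omega> rule: finite_induct)
  case empty
  then show ?case by blast
next
  case (insert j J)
  have "\<exists>i\<in>I. H i j p \<noteq> 0"
  proof (rule ccontr)
    assume "\<not> ?thesis"
    then have "(if j = j then 1 else 0 :: real) = 0"
      by (intro insert.prems(6)[of "\<lambda>k. if k = j then 1 else 0"])
         (auto simp: if_distrib sum.delta insert.hyps cong: if_cong)
    then show False by simp
  qed
  then obtain i where i: "i \<in> I" "H i j p \<noteq> 0" by blast
  define N1 where "N1 = {q \<in> N. H i j q \<noteq> 0}"
  have N1: "open N1" "p \<in> N1" "N1 \<subseteq> N"
  proof -
    have "open (N \<inter> H i j -` (- {0}))"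
      by (intro continuous_open_preimage smooth_fun_on_imp_continuous_on insert.prems i) auto
    moreover have "N \<inter> H i j -` (- {0}) = N1" by (auto simp: N1_def)
    ultimately show "open N1" by simp
  qed (use insert.prems(2) i in \<open>auto simp: N1_def\<close>)
  \<comment> \<open>Subtracting \<open>r b\<close> times the pivot row clears the entry of row \<open>b\<close> in column \<open>j\<close>.\<close>
  define r where "r = (\<lambda>b q. H b j q * inverse (H i j q))"
  have Hs: "smooth_fun_on A N1 (H b k)" if "b \<in> I" "k \<in> insert j J" for b k
    using insert.prems(3)[OF that] N1(3) smooth_fun_on_subset by blast
  have os: "smooth_fun_on A N1 (\<omega> b)" if "b \<in> I" for b
    using insert.prems(4)[OF that] N1(3) smooth_fun_on_subset by blast
  have iv: "smooth_fun_on A N1 (\<lambda>q. inverse (H i j q))"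
    by (rule smooth_fun_on_inverse[OF N1(1) Hs]) (use i in \<open>auto simp: N1_def\<close>)
  have rs: "smooth_fun_on A N1 (r b)" if "b \<in> I" for b
    unfolding r_def using that by (intro smooth_fun_on_mult N1(1) Hs iv) auto
  have row: "H b j q * W j q + (\<Sum>k\<in>J. H b k q * W k q) = \<omega> b q" if "b \<in> I" "q \<in> N1" for b q
    using insert.prems(5)[OF that(1), of q] that(2) N1(3) insert.hyps by auto
  have Wj: "W j q = inverse (H i j q) * (\<omega> i q - (\<Sum>k\<in>J. H i k q * W k q))" if "q \<in> N1" for q
    using row[OF i(1) that] that by (simp add: N1_def field_simps)
  have "\<exists>N'. open N' \<and> p \<in> N' \<and> (\<forall>k\<in>J. smooth_fun_on A N' (W k))"
  proof (rule insert.IH[of N1 "\<lambda>b k q. H b k q - r b q * H i k q" "\<lambda>b q. \<omega> b q - r b q * \<omega> i q"])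
    show "smooth_fun_on A N1 (\<lambda>q. H b k q - r b q * H i k q)" if "b \<in> I" "k \<in> J" for b k
      using that i by (intro smooth_fun_on_diff smooth_fun_on_mult N1(1) Hs rs) auto
    show "smooth_fun_on A N1 (\<lambda>q. \<omega> b q - r b q * \<omega> i q)" if "b \<in> I" for b
      using that i by (intro smooth_fun_on_diff smooth_fun_on_mult N1(1) os rs) auto
    show "(\<Sum>k\<in>J. (H b k q - r b q * H i k q) * W k q) = \<omega> b q - r b q * \<omega> i q"
      if "b \<in> I" "q \<in> N1" for b q
    proof -
      have "(\<Sum>k\<in>J. (H b k q - r b q * H i k q) * W k q) =
          (\<Sum>k\<in>J. H b k q * W k q) - r b q * (\<Sum>k\<in>J. H i k q * W k q)"
        by (simp add: algebra_simps sum_subtractf sum_distrib_left)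
      also have "\<dots> = (\<omega> b q - H b j q * W j q) - r b q * (\<omega> i q - H i j q * W j q)"
        using row[OF that, THEN eq_diff_eq[THEN iffD2, OF trans[OF add.commute]]]
          row[OF i(1) that(2), THEN eq_diff_eq[THEN iffD2, OF trans[OF add.commute]]] by simp
      also have "\<dots> = \<omega> b q - r b q * \<omega> i q"
        using that(2) by (simp add: r_def N1_def field_simps)
      finally show ?thesis .
    qed
    show "c k = 0" if c: "\<And>b. b \<in> I \<Longrightarrow> (\<Sum>k\<in>J. (H b k p - r b p * H i k p) * c k) = 0" and k: "k \<in> J" for c k
    proof -
      \<comment> \<open>The value at \<open>j\<close> is the one that solves the pivot row.\<close>
      define d where "d = c(j := - inverse (H i j p) * (\<Sum>k\<in>J. H i k p * c k))"
      have dJ: "(\<Sum>k\<in>J. H b k p * d k) = (\<Sum>k\<in>J. H b k p * c k)" for b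
        by (rule sum.cong) (use insert.hyps in \<open>auto simp: d_def\<close>)
      have "(\<Sum>k\<in>insert j J. H b k p * d k) = 0" if "b \<in> I" for b
      proof -
        have "(\<Sum>k\<in>J. H b k p * c k) = r b p * (\<Sum>k\<in>J. H i k p * c k)"
          using c[OF that] by (simp add: algebra_simps sum_subtractf sum_distrib_left)
        then show ?thesis
          using insert.hyps by (simp add: dJ) (simp add: d_def r_def)
      qed
      then have "d k = 0" by (rule insert.prems(6)) (use k in auto)
      then show ?thesis using k insert.hyps by (auto simp: d_def split: if_splits)
    qed
  qed (use N1 in auto)
  then obtain N2 where N2: "open N2" "p \<in> N2" "\<And>k. k \<in> J \<Longrightarrow> smooth_fun_on A N2 (W k)" by blast
  let ?N = "N1 \<inter> N2"
  have o: "open ?N" using N1(1) N2(1) by auto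
  have W2: "smooth_fun_on A ?N (W k)" if "k \<in> J" for k
    using N2(3)[OF that] smooth_fun_on_subset by blast
  have "smooth_fun_on A ?N (\<lambda>q. inverse (H i j q) * (\<omega> i q - (\<Sum>k\<in>J. H i k q * W k q)))"
    by (intro smooth_fun_on_mult smooth_fun_on_diff smooth_fun_on_sum o W2
        smooth_fun_on_subset[OF iv] smooth_fun_on_subset[OF os] smooth_fun_on_subset[OF Hs])
       (use i in auto)
  then have "smooth_fun_on A ?N (W j)"
    by (rule smooth_fun_on_cong[OF o, rotated]) (simp add: Wj)
  then show ?case using o W2 N1(2) N2(2) by blast
qed

end

section \<open>Tangent vectors and local frames\<close>

lemma sum_apply: "(\<Sum>i\<in>I. F i) x = (\<Sum>i\<in>I. F i x)"
  for F :: "'i \<Rightarrow> 'a \<Rightarrow> 'b::comm_monoid_add"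
  by (induction I rule: infinite_finite_induct) auto

context smooth_manifold
begin

lemma tangent_add:
  "v \<in> tangent_space A p \<Longrightarrow> smooth_fun A f \<Longrightarrow> smooth_fun A h \<Longrightarrow> v (\<lambda>q. f q + h q) = v f + v h"
  by (simp add: tangent_space_def)

lemma tangent_scale: "v \<in> tangent_space A p \<Longrightarrow> smooth_fun A f \<Longrightarrow> v (\<lambda>q. c * f q) = c * v f"
  by (simp add: tangent_space_def)

lemma tangent_mult:
  "v \<in> tangent_space A p \<Longrightarrow> smooth_fun A f \<Longrightarrow> smooth_fun A h \<Longrightarrow>
    v (\<lambda>q. f q * h q) = f p * v h + h p * v f"
  by (simp add: tangent_space_def)

lemma tangent_not_smooth: "v \<in> tangent_space A p \<Longrightarrow> \<not> smooth_fun A f \<Longrightarrow> v f = 0"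
  by (simp add: tangent_space_def)

lemma tangent_diff:
  assumes "v \<in> tangent_space A p" "smooth_fun A f" "smooth_fun A h"
  shows "v (\<lambda>q. f q - h q) = v f - v h"
  using tangent_add[OF assms(1,2) smooth_fun_mult[OF smooth_fun_const assms(3)], of "-1"]
    tangent_scale[OF assms(1,3), of "-1"] by simp

lemma tangent_const:
  assumes "v \<in> tangent_space A p"
  shows "v (\<lambda>q. c) = 0"
  using tangent_mult[OF assms smooth_fun_const[of 1] smooth_fun_const[of 1]]
    tangent_scale[OF assms smooth_fun_const[of 1], of c] by simp

lemma tangent_sum:
  assumes "v \<in> tangent_space A p" "\<And>i. i \<in> I \<Longrightarrow> smooth_fun A (f i)"
  shows "v (\<lambda>q. \<Sum>i\<in>I. f i q) = (\<Sum>i\<in>I. v (f i))"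
  using assms(2)
  by (induction I rule: infinite_finite_induct)
     (auto simp: tangent_const[OF assms(1)] tangent_add[OF assms(1)] smooth_fun_sum)

lemma subspace_tangent_space: "fspace.subspace (tangent_space A p)"
  unfolding fspace.subspace_def tangent_space_def
  by (auto simp: fscale_def algebra_simps)

lemmas tangent_space_add = fspace.subspace_add[OF subspace_tangent_space]
lemmas tangent_space_diff = fspace.subspace_diff[OF subspace_tangent_space]
lemmas tangent_space_scale = fspace.subspace_scale[OF subspace_tangent_space]
lemmas tangent_space_sum = fspace.subspace_sum[OF subspace_tangent_space]
lemmas tangent_space_0 = fspace.subspace_0[OF subspace_tangent_space]

lemma tangent_eqI:
  assumes "v \<in> tangent_space A p" "w \<in> tangent_space A p" "\<And>f. smooth_fun A f \<Longrightarrow> v f = w f"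
  shows "v = w"
proof
  show "v f = w f" for f
    using assms tangent_not_smooth by (cases "smooth_fun A f") metis+
qed

lemma vector_field_at: "X \<in> vector_fields A \<Longrightarrow> X p \<in> tangent_space A p"
  by (simp add: vector_fields_def)

lemma vector_field_smooth: "X \<in> vector_fields A \<Longrightarrow> smooth_fun A f \<Longrightarrow> smooth_fun A (\<lambda>p. X p f)"
  by (simp add: vector_fields_def)

lemma vector_field_add:
  "X \<in> vector_fields A \<Longrightarrow> Y \<in> vector_fields A \<Longrightarrow> (\<lambda>p. X p + Y p) \<in> vector_fields A"
  by (auto simp: vector_fields_def tangent_space_add intro!: smooth_fun_add)

lemma vector_field_scale:
  "smooth_fun A f \<Longrightarrow> X \<in> vector_fields A \<Longrightarrow> (\<lambda>p. fscale (f p) (X p)) \<in> vector_fields A"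
  unfolding vector_fields_def
  by (auto simp: tangent_space_scale) (auto simp: fscale_def intro!: smooth_fun_mult)

lemma vector_field_0: "(\<lambda>p. 0) \<in> vector_fields A"
  by (auto simp: vector_fields_def tangent_space_0 smooth_fun_const)

lemma vector_field_sum:
  "(\<And>i. i \<in> I \<Longrightarrow> X i \<in> vector_fields A) \<Longrightarrow> (\<lambda>p. \<Sum>i\<in>I. X i p) \<in> vector_fields A"
  by (induction I rule: infinite_finite_induct) (auto intro: vector_field_0 vector_field_add)

lemma lie_bracket_vector_field:
  assumes X: "X \<in> vector_fields A" and Y: "Y \<in> vector_fields A"
  shows "lie_bracket X Y \<in> vector_fields A"
proof -
  note s = vector_field_smooth[OF X] vector_field_smooth[OF Y]
  note t = vector_field_at[OF X] vector_field_at[OF Y]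
  have "lie_bracket X Y p \<in> tangent_space A p" for p
    unfolding tangent_space_def lie_bracket_def
  proof (intro CollectI conjI allI impI)
    fix f h assume f: "smooth_fun A f" and h: "smooth_fun A h"
    note fh = f h s(1)[OF f] s(2)[OF f] s(1)[OF h] s(2)[OF h]
    show "X p (\<lambda>q. Y q (\<lambda>q. f q + h q)) - Y p (\<lambda>q. X q (\<lambda>q. f q + h q)) =
        X p (\<lambda>q. Y q f) - Y p (\<lambda>q. X q f) + (X p (\<lambda>q. Y q h) - Y p (\<lambda>q. X q h))"
      by (simp add: tangent_add[OF t(1)] tangent_add[OF t(2)] fh)
    show "X p (\<lambda>q. Y q (\<lambda>q. f q * h q)) - Y p (\<lambda>q. X q (\<lambda>q. f q * h q)) =
        f p * (X p (\<lambda>q. Y q h) - Y p (\<lambda>q. X q h)) + h p * (X p (\<lambda>q. Y q f) - Y p (\<lambda>q. X q f))"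
      by (simp add: tangent_mult[OF t(1)] tangent_mult[OF t(2)] tangent_add[OF t(1)]
          tangent_add[OF t(2)] fh smooth_fun_mult) (simp add: algebra_simps)
  next
    fix c f assume f: "smooth_fun A f"
    show "X p (\<lambda>q. Y q (\<lambda>q. c * f q)) - Y p (\<lambda>q. X q (\<lambda>q. c * f q)) =
        c * (X p (\<lambda>q. Y q f) - Y p (\<lambda>q. X q f))"
      by (simp add: tangent_scale[OF t(1)] tangent_scale[OF t(2)] f s right_diff_distrib)
  next
    fix f assume "\<not> smooth_fun A f"
    then have "X q f = 0" "Y q f = 0" for q
      using tangent_not_smooth t by blast+
    then show "X p (\<lambda>q. Y q f) - Y p (\<lambda>q. X q f) = 0"
      by (simp add: tangent_const[OF t(1)] tangent_const[OF t(2)])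
  qed
  moreover have "smooth_fun A (\<lambda>p. lie_bracket X Y p f)" if "smooth_fun A f" for f
    unfolding lie_bracket_def using that by (intro smooth_fun_diff s)
  ultimately show ?thesis by (simp add: vector_fields_def)
qed

text \<open>
  Coordinates \<open>y\<close> and coordinate fields \<open>E\<close> around \<open>p\<close>, all defined on the whole manifold but behaving
  as coordinates only on \<open>N\<close>. The cut-off \<open>\<beta>\<close> makes local expansions global: for a vector field \<open>X\<close>, the
  field \<open>\<beta>X\<close> is a combination of the \<open>E\<close> with globally smooth coefficients \<open>\<beta> X(y)\<close>.
  Duality of \<open>y\<close> and \<open>E\<close> is recorded at \<open>p\<close> alone: it expresses that the \<open>E\<close> are independent there.
\<close>

definition local_frame ::
  "'m \<Rightarrow> 'm set \<Rightarrow> ('e \<Rightarrow> 'm \<Rightarrow> real) \<Rightarrow> ('e \<Rightarrow> 'm vfield) \<Rightarrow> ('m \<Rightarrow> real) \<Rightarrow> bool" where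
  "local_frame p N y E \<beta> \<longleftrightarrow> open N \<and> p \<in> N \<and>
     (\<forall>b. smooth_fun A (y b)) \<and> (\<forall>b. E b \<in> vector_fields A) \<and>
     smooth_fun A \<beta> \<and> \<beta> p = 1 \<and> (\<forall>q. q \<notin> N \<longrightarrow> \<beta> q = 0) \<and>
     (\<forall>q\<in>N. \<forall>v\<in>tangent_space A q. v = (\<Sum>b\<in>Basis. fscale (v (y b)) (E b q))) \<and>
     (\<forall>b\<in>Basis. \<forall>c\<in>Basis. E b p (y c) = (if b = c then 1 else 0))"

lemma local_frameD:
  assumes "local_frame p N y E \<beta>"
  shows "open N" "p \<in> N" "smooth_fun A (y b)" "E b \<in> vector_fields A" "smooth_fun A \<beta>" "\<beta> p = 1"
    "q \<notin> N \<Longrightarrow> \<beta> q = 0"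
    "q \<in> N \<Longrightarrow> v \<in> tangent_space A q \<Longrightarrow> v = (\<Sum>b\<in>Basis. fscale (v (y b)) (E b q))"
    "b \<in> Basis \<Longrightarrow> c \<in> Basis \<Longrightarrow> E b p (y c) = (if b = c then 1 else 0)"
  using assms unfolding local_frame_def by blast+

text \<open>
  Inside a chart, multiply the coordinates and the partial derivatives by a plateau function \<open>\<eta>\<close> equal
  to 1 on the ball \<open>B\<close>. That these fields span is Hadamard's lemma: for \<open>q\<close> with chart image in \<open>B\<close> and
  a bump \<open>t\<close> with \<open>t(q) = 1\<close>, it gives
  \<open>t f = f(q) t + \<Sum>\<^sub>b (y\<^sub>b - y\<^sub>b(q)) k\<^sub>b\<close> with globally smooth \<open>k\<^sub>b\<close>. A derivation \<open>v\<close> at \<open>q\<close> takes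
  the left side to \<open>v(f) + f(q) v(t)\<close> and the right side to \<open>f(q) v(t) + \<Sum>\<^sub>b k\<^sub>b(q) v(y\<^sub>b)\<close>.
\<close>

lemma local_frame_exists: "\<exists>N y E \<beta>. local_frame p N y E \<beta>"
proof -
  obtain U \<phi> where U: "(U, \<phi>) \<in> A" "p \<in> U" by (rule chart_at)
  note ch = chart[OF U(1)]
  let ?x = "\<phi> p" and ?j = "inv_into U \<phi>"
  obtain e where e: "e > 0" "ball ?x e \<subseteq> \<phi> ` U"
    using ch(2) U(2) by (meson openE image_eqI)
  have eb: "0 < e / 3" "e / 3 < e / 2" "0 < e / 5" "e / 5 < e / 4" using e(1) by auto
  define B where "B = ball ?x (e / 3)"
  have B: "open B" "convex B" "?x \<in> B" "B \<subseteq> \<phi> ` U"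
    using e by (auto simp: B_def)
  obtain \<eta> :: "'e \<Rightarrow> real" where \<eta>: "smooth_on UNIV \<eta>" "\<And>x. dist ?x x \<le> e / 3 \<Longrightarrow> \<eta> x = 1"
    "\<And>x. dist ?x x \<ge> e / 2 \<Longrightarrow> \<eta> x = 0"
    using smooth_bump[OF eb(1,2), of ?x] by blast
  have \<eta>U: "smooth_on (\<phi> ` U) \<eta>" using \<eta>(1) smooth_on_subset by blast
  define N where "N = U \<inter> \<phi> -` B"
  have N: "open N" "p \<in> N"
    using continuous_open_preimage[OF ch(3,1) B(1)] U(2) B(3) by (auto simp: N_def)
  have NB: "\<phi> q \<in> B" "q \<in> U" if "q \<in> N" for q using that by (auto simp: N_def)
  have ext: "smooth_fun A (\<lambda>q. if q \<in> U then G (\<phi> q) else 0)"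
    if "smooth_on (\<phi> ` U) G" "\<And>x. dist ?x x \<ge> e / 2 \<Longrightarrow> G x = 0" for G
  proof (rule smooth_fun_extend_by_zero[OF U(1) that(1)])
    show "compact (cball ?x (e / 2))" by simp
    show "cball ?x (e / 2) \<subseteq> \<phi> ` U" using e by (auto simp: subset_iff)
    show "G x = 0" if "x \<notin> cball ?x (e / 2)" for x
      using that by (intro \<open>\<And>x. dist ?x x \<ge> e / 2 \<Longrightarrow> G x = 0\<close>) auto
  qed
  define y where "y = (\<lambda>b q. if q \<in> U then \<eta> (\<phi> q) * (\<phi> q \<bullet> b) else 0)"
  have y: "smooth_fun A (y b)" for b
    unfolding y_def
    by (rule ext[of "\<lambda>x. \<eta> x * (x \<bullet> b)"])
       (simp_all add: \<eta>(3) smooth_on_mult[OF ch(2) \<eta>U smooth_on_linear[OF ch(2) bounded_linear_inner_left]])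
  define E where "E = (\<lambda>b q f. if q \<in> U \<and> smooth_fun A f
     then \<eta> (\<phi> q) * frechet_derivative (f \<circ> ?j) (at (\<phi> q)) b else 0)"
  have sm: "smooth_on (\<phi> ` U) (f \<circ> ?j)" if "smooth_fun A f" for f
    using that U(1) unfolding smooth_fun_def by blast
  have fd: "((f \<circ> ?j) has_derivative frechet_derivative (f \<circ> ?j) (at (\<phi> q))) (at (\<phi> q))"
    if "smooth_fun A f" "q \<in> U" for f q
    by (rule smooth_on_imp_has_derivative[OF sm[OF that(1)]]) (use that in auto)
  have E: "E b \<in> vector_fields A" for b
    unfolding vector_fields_def
  proof (clarify, intro conjI allI impI)
    fix f assume f: "smooth_fun A f"
    have "smooth_fun A (\<lambda>q. if q \<in> U then \<eta> (\<phi> q) * frechet_derivative (f \<circ> ?j) (at (\<phi> q)) b else 0)"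
      by (rule ext[of "\<lambda>x. \<eta> x * frechet_derivative (f \<circ> ?j) (at x) b"])
         (auto simp: \<eta>(3) intro!: smooth_on_mult \<eta>U ch(2) smooth_on_frechet_derivative sm[OF f])
    then show "smooth_fun A (\<lambda>q. E b q f)" by (simp add: E_def f cong: if_cong)
  next
    fix q
    show "E b q \<in> tangent_space A q"
    proof (cases "q \<in> U")
      case False
      then show ?thesis by (simp add: E_def tangent_space_def)
    next
      case True
      have "frechet_derivative ((\<lambda>q. f q + h q) \<circ> ?j) (at (\<phi> q)) =
        (\<lambda>b. frechet_derivative (f \<circ> ?j) (at (\<phi> q)) b + frechet_derivative (h \<circ> ?j) (at (\<phi> q)) b)"
        if "smooth_fun A f" "smooth_fun A h" for f h
        using has_derivative_add[OF fd[OF that(1) True] fd[OF that(2) True]]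
        by (intro frechet_derivative_at[symmetric]) (simp add: o_def)
      moreover have "frechet_derivative ((\<lambda>q. c * f q) \<circ> ?j) (at (\<phi> q)) =
        (\<lambda>b. c * frechet_derivative (f \<circ> ?j) (at (\<phi> q)) b)"
        if "smooth_fun A f" for f c
        using has_derivative_mult_right[OF fd[OF that True]]
        by (intro frechet_derivative_at[symmetric]) (simp add: o_def)
      moreover have "frechet_derivative ((\<lambda>q. f q * h q) \<circ> ?j) (at (\<phi> q)) =
        (\<lambda>b. f q * frechet_derivative (h \<circ> ?j) (at (\<phi> q)) b +
           frechet_derivative (f \<circ> ?j) (at (\<phi> q)) b * h q)"
        if "smooth_fun A f" "smooth_fun A h" for f h
        using has_derivative_mult[OF fd[OF that(1) True] fd[OF that(2) True]] ch(5)[OF True]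
        by (intro frechet_derivative_at[symmetric]) (simp add: o_def)
      ultimately show ?thesis
        by (simp add: E_def tangent_space_def True smooth_fun_intros algebra_simps)
    qed
  qed
  have EB: "E b q f = frechet_derivative (f \<circ> ?j) (at (\<phi> q)) b" if "q \<in> N" "smooth_fun A f" for b q f
    using that \<eta>(2)[of "\<phi> q"] by (auto simp: E_def N_def B_def)
  have yB: "y b q = \<phi> q \<bullet> b" if "q \<in> N" for b q
    using that \<eta>(2)[of "\<phi> q"] by (auto simp: y_def N_def B_def)
  have dual: "E b p (y c) = (if b = c then 1 else 0)" if bc: "b \<in> Basis" "c \<in> Basis" for b c
  proof -
    have "((\<lambda>x. x \<bullet> c) has_derivative (\<lambda>v. v \<bullet> c)) (at ?x)"
      by (auto intro!: derivative_eq_intros)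
    then have "((y c \<circ> ?j) has_derivative (\<lambda>v. v \<bullet> c)) (at ?x)"
    proof (rule has_derivative_transform_within_open[OF _ B(1,3)])
      show "x \<bullet> c = (y c \<circ> ?j) x" if "x \<in> B" for x
        using that B(4) ch(5) yB by (fastforce simp: N_def)
    qed
    then have "frechet_derivative (y c \<circ> ?j) (at ?x) = (\<lambda>v. v \<bullet> c)"
      by (rule frechet_derivative_at[symmetric])
    then show ?thesis using EB[OF N(2) y] bc by (simp add: inner_Basis)
  qed
  have span: "v = (\<Sum>b\<in>Basis. fscale (v (y b)) (E b q))"
    if q: "q \<in> N" and v: "v \<in> tangent_space A q" for q v
  proof (rule tangent_eqI[OF v])
    show "(\<Sum>b\<in>Basis. fscale (v (y b)) (E b q)) \<in> tangent_space A q"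
      by (intro tangent_space_sum tangent_space_scale vector_field_at E)
    fix f assume f: "smooth_fun A f"
    obtain G where G: "\<And>b. smooth_on B (G b)"
      "\<And>x. x \<in> B \<Longrightarrow> (f \<circ> ?j) x = (f \<circ> ?j) (\<phi> q) + (\<Sum>b\<in>Basis. ((x - \<phi> q) \<bullet> b) * G b x)"
      "\<And>b. G b (\<phi> q) = frechet_derivative (f \<circ> ?j) (at (\<phi> q)) b"
      using Hadamard[OF B(1,2) NB(1)[OF q] smooth_on_subset[OF sm[OF f] B(4)]] by blast
    obtain d where d: "d > 0" "ball (\<phi> q) d \<subseteq> B" using B(1) NB(1)[OF q] by (meson openE)
    have db: "0 < d / 3" "d / 3 < d / 2" using d(1) by auto
    obtain \<theta> :: "'e \<Rightarrow> real" where \<theta>: "smooth_on UNIV \<theta>" "\<And>x. dist (\<phi> q) x \<le> d / 3 \<Longrightarrow> \<theta> x = 1"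
      "\<And>x. dist (\<phi> q) x \<ge> d / 2 \<Longrightarrow> \<theta> x = 0"
      using smooth_bump[OF db, of "\<phi> q"] by blast
    have dB: "cball (\<phi> q) (d / 2) \<subseteq> B" using d by (auto simp: subset_iff)
    have \<theta>B: "x \<in> B" if "\<theta> x \<noteq> 0" for x
    proof -
      have "dist (\<phi> q) x \<le> d / 2" using \<theta>(3)[of x] that by linarith
      then show ?thesis using dB by auto
    qed
    have ext': "smooth_fun A (\<lambda>q. if q \<in> U then \<theta> (\<phi> q) * G (\<phi> q) else 0)"
      if G: "smooth_on B G" for G
    proof (rule smooth_fun_extend_by_zero[OF U(1), of "\<lambda>x. \<theta> x * G x"])
      show "compact (cball (\<phi> q) (d / 2))" by simp
      show "cball (\<phi> q) (d / 2) \<subseteq> \<phi> ` U" using dB B(4) by blast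
      show "\<theta> x * G x = 0" if "x \<notin> cball (\<phi> q) (d / 2)" for x
        using that \<theta>(3)[of x] by auto
      show "smooth_on (\<phi> ` U) (\<lambda>x. \<theta> x * G x)"
      proof (rule smooth_on_local)
        fix x
        show "\<exists>T. open T \<and> x \<in> T \<and> smooth_on T (\<lambda>x. \<theta> x * G x)"
        proof (cases "x \<in> B")
          case True
          have "smooth_on B (\<lambda>x. \<theta> x * G x)"
            by (intro smooth_on_mult B(1) G smooth_on_subset[OF \<theta>(1)]) simp
          then show ?thesis using True B(1) by blast
        next
          case False
          have o: "open (- cball (\<phi> q) (d / 2))" by (simp add: open_Compl)
          have "smooth_on (- cball (\<phi> q) (d / 2)) (\<lambda>x. \<theta> x * G x)"
            by (rule smooth_on_cong[OF o _ smooth_on_const[OF o, of 0]]) (auto simp: \<theta>(3))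
          then show ?thesis using False dB o by blast
        qed
      qed
    qed
    define t where "t = (\<lambda>q. if q \<in> U then \<theta> (\<phi> q) * 1 else 0)"
    define k where "k = (\<lambda>b q. if q \<in> U then \<theta> (\<phi> q) * G b (\<phi> q) else 0)"
    have t: "smooth_fun A t" unfolding t_def by (rule ext') (rule smooth_on_const[OF B(1)])
    have k: "smooth_fun A (k b)" for b unfolding k_def by (rule ext') (rule G(1))
    have tq: "t q = 1" using NB[OF q] \<theta>(2)[of "\<phi> q"] d by (simp add: t_def)
    have yq: "y b q = \<phi> q \<bullet> b" for b using yB[OF q] .
    have "t z * f z = f q * t z + (\<Sum>b\<in>Basis. (y b z - \<phi> q \<bullet> b) * k b z)" for z
    proof (cases "z \<in> U \<and> \<theta> (\<phi> z) \<noteq> 0")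
      case True
      then have z: "\<phi> z \<in> B" "z \<in> N" using \<theta>B by (auto simp: N_def)
      have "f z = f q + (\<Sum>b\<in>Basis. (y b z - \<phi> q \<bullet> b) * G b (\<phi> z))"
        using G(2)[OF z(1)] ch(5) True NB(2)[OF q] yB[OF z(2)] by (simp add: inner_diff_left)
      then show ?thesis
        using True by (simp add: t_def k_def algebra_simps sum_distrib_left)
    next
      case False
      then show ?thesis by (auto simp: t_def k_def)
    qed
    then have "v (\<lambda>z. t z * f z) = v (\<lambda>z. f q * t z + (\<Sum>b\<in>Basis. (y b z - \<phi> q \<bullet> b) * k b z))"
      by simp
    moreover have "v (\<lambda>z. t z * f z) = v f + f q * v t"
      by (simp add: tangent_mult[OF v] t f tq)
    moreover have "v (\<lambda>z. f q * t z + (\<Sum>b\<in>Basis. (y b z - \<phi> q \<bullet> b) * k b z)) =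
        f q * v t + (\<Sum>b\<in>Basis. k b q * v (y b))"
      by (simp add: tangent_add[OF v] tangent_scale[OF v] tangent_sum[OF v] tangent_mult[OF v]
          tangent_diff[OF v] tangent_const[OF v] smooth_fun_intros y k t yq)
    moreover have "k b q = E b q f" for b
      using EB[OF q f] G(3) NB[OF q] \<theta>(2)[of "\<phi> q"] d by (simp add: k_def)
    ultimately show "v f = (\<Sum>b\<in>Basis. fscale (v (y b)) (E b q)) f"
      by (simp add: sum_apply fscale_def mult.commute)
  qed
  obtain \<beta>0 :: "'e \<Rightarrow> real" where \<beta>0: "smooth_on UNIV \<beta>0" "\<And>x. dist ?x x \<le> e / 5 \<Longrightarrow> \<beta>0 x = 1"
    "\<And>x. dist ?x x \<ge> e / 4 \<Longrightarrow> \<beta>0 x = 0"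
    using smooth_bump[OF eb(3,4), of ?x] by blast
  define \<beta> where "\<beta> = (\<lambda>q. if q \<in> U then \<beta>0 (\<phi> q) else 0)"
  have "smooth_fun A \<beta>"
    unfolding \<beta>_def using e by (intro ext smooth_on_subset[OF \<beta>0(1)] \<beta>0(3)) auto
  moreover have "\<beta> p = 1" using U(2) e \<beta>0(2)[of ?x] by (simp add: \<beta>_def)
  moreover have "\<beta> q = 0" if "q \<notin> N" for q
    using that e \<beta>0(3)[of "\<phi> q"] by (auto simp: \<beta>_def N_def B_def)
  ultimately have "local_frame p N y E \<beta>"
    unfolding local_frame_def using N y E span dual by blast
  then show ?thesis by blast
qed

lemma vector_field_through:
  assumes "v \<in> tangent_space A p"
  obtains Z where "Z \<in> vector_fields A" "Z p = v"
proof -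
  obtain N y E \<beta> where "local_frame p N y E \<beta>" using local_frame_exists by blast
  note f = local_frameD[OF this]
  show ?thesis
    by (rule that[of "\<lambda>q. \<Sum>b\<in>Basis. fscale (v (y b)) (E b q)"])
       (use f(8)[OF f(2) assms] in \<open>auto intro!: vector_field_sum vector_field_scale smooth_fun_const f(4)\<close>)
qed

section \<open>Tensor fields and duality\<close>

lemma linear_on_tangent_add:
  "linear_on_tangent A p \<alpha> \<Longrightarrow> v \<in> tangent_space A p \<Longrightarrow> w \<in> tangent_space A p \<Longrightarrow>
    \<alpha> (v + w) = \<alpha> v + \<alpha> w"
  by (simp add: linear_on_tangent_def)

lemma linear_on_tangent_scale:
  "linear_on_tangent A p \<alpha> \<Longrightarrow> v \<in> tangent_space A p \<Longrightarrow> \<alpha> (fscale c v) = c * \<alpha> v"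
  by (simp add: linear_on_tangent_def)

lemma linear_on_tangent_sum:
  assumes "linear_on_tangent A p \<alpha>" "\<And>i. i \<in> I \<Longrightarrow> v i \<in> tangent_space A p"
  shows "\<alpha> (\<Sum>i\<in>I. fscale (c i) (v i)) = (\<Sum>i\<in>I. c i * \<alpha> (v i))"
proof -
  have "\<alpha> 0 = 0"
    using linear_on_tangent_scale[OF assms(1) tangent_space_0, of 0] by simp
  then show ?thesis
    using assms(2)
    by (induction I rule: infinite_finite_induct)
       (simp_all add: linear_on_tangent_add[OF assms(1)] linear_on_tangent_scale[OF assms(1)]
         tangent_space_scale tangent_space_sum)
qed

lemma tensor_sym:
  "h \<in> symmetric_tensor_fields A \<Longrightarrow> v \<in> tangent_space A p \<Longrightarrow> w \<in> tangent_space A p \<Longrightarrow>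
    h p v w = h p w v"
  by (simp add: symmetric_tensor_fields_def)

lemma tensor_linear_right:
  "h \<in> symmetric_tensor_fields A \<Longrightarrow> v \<in> tangent_space A p \<Longrightarrow> linear_on_tangent A p (h p v)"
  by (simp add: symmetric_tensor_fields_def)

lemma tensor_linear_left:
  "h \<in> symmetric_tensor_fields A \<Longrightarrow> w \<in> tangent_space A p \<Longrightarrow> linear_on_tangent A p (\<lambda>v. h p v w)"
  using tensor_linear_right[of h w p]
  by (auto simp: linear_on_tangent_def tensor_sym[of h _ p w] tangent_space_add tangent_space_scale)

lemma tensor_smooth:
  "h \<in> symmetric_tensor_fields A \<Longrightarrow> X \<in> vector_fields A \<Longrightarrow> Y \<in> vector_fields A \<Longrightarrow>
    smooth_fun A (\<lambda>p. h p (X p) (Y p))"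
  by (simp add: symmetric_tensor_fields_def)

lemma nondegenerate_eqI:
  assumes h: "h \<in> symmetric_tensor_fields A"
    and nondeg: "\<And>p v. v \<in> tangent_space A p \<Longrightarrow> (\<And>w. w \<in> tangent_space A p \<Longrightarrow> h p v w = 0) \<Longrightarrow> v = 0"
    and W: "W \<in> vector_fields A" "W' \<in> vector_fields A"
    and eq: "\<And>Z p. Z \<in> vector_fields A \<Longrightarrow> h p (W p) (Z p) = h p (W' p) (Z p)"
  shows "W = W'"
proof
  fix p
  note t = vector_field_at[OF W(1), of p] vector_field_at[OF W(2), of p]
  have "W p - W' p = 0"
  proof (rule nondeg)
    show "W p - W' p \<in> tangent_space A p" using t by (rule tangent_space_diff)
    fix w assume w: "w \<in> tangent_space A p"
    obtain Z where Z: "Z \<in> vector_fields A" "Z p = w" using vector_field_through[OF w] .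
    note lin = tensor_linear_left[OF h w]
    have "h p (W p - W' p) w = h p (W p + fscale (- 1) (W' p)) w" by simp
    also have "\<dots> = h p (W p) w + (- 1) * h p (W' p) w"
      by (simp only: linear_on_tangent_add[OF lin] linear_on_tangent_scale[OF lin]
          tangent_space_scale t)
    finally show "h p (W p - W' p) w = 0" using eq[OF Z(1), of p] Z(2) by simp
  qed
  then show "W p = W' p" by simp
qed

text \<open>
  At a point \<open>p\<close>, nondegeneracy makes \<open>w \<mapsto> (h(w, E\<^sub>b))\<^sub>b\<close> an injective, hence surjective, linear map in
  finite dimension, so some \<open>w\<close> has the required values on the frame. That it has them on all \<open>Z\<close> uses
  that \<open>\<omega>\<close> is a tensor: \<open>\<omega>(Z)(p) = \<omega>(\<beta>Z)(p)\<close>, and \<open>\<beta>Z\<close> is a combination of the frame fields. The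
  coefficients of the resulting field solve the smooth linear system
  \<open>\<Sum>\<^sub>c h(E\<^sub>c, E\<^sub>b) W\<^sup>c = \<omega>(E\<^sub>b)\<close>, so they are smooth.
\<close>

lemma sharp_exists:
  assumes h: "h \<in> symmetric_tensor_fields A"
    and nondeg: "\<And>p v. v \<in> tangent_space A p \<Longrightarrow> (\<And>w. w \<in> tangent_space A p \<Longrightarrow> h p v w = 0) \<Longrightarrow> v = 0"
    and add: "\<And>Z Z' p. Z \<in> vector_fields A \<Longrightarrow> Z' \<in> vector_fields A \<Longrightarrow>
      \<omega> (\<lambda>p. Z p + Z' p) p = \<omega> Z p + \<omega> Z' p"
    and scale: "\<And>f Z p. smooth_fun A f \<Longrightarrow> Z \<in> vector_fields A \<Longrightarrow>
      \<omega> (\<lambda>p. fscale (f p) (Z p)) p = f p * \<omega> Z p"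
    and smooth: "\<And>Z. Z \<in> vector_fields A \<Longrightarrow> smooth_fun A (\<omega> Z)"
  shows "\<exists>W\<in>vector_fields A. \<forall>Z\<in>vector_fields A. \<forall>p. h p (W p) (Z p) = \<omega> Z p"
proof -
  have sum: "\<omega> (\<lambda>p. \<Sum>i\<in>I. Z i p) p = (\<Sum>i\<in>I. \<omega> (Z i) p)"
    if "\<And>i. i \<in> I \<Longrightarrow> Z i \<in> vector_fields A" for I :: "'e set" and Z p
  proof -
    have "\<omega> (\<lambda>p. 0) p = 0"
      using scale[OF smooth_fun_const vector_field_0, of 0 p] by simp
    then show ?thesis
      using that by (induction I rule: infinite_finite_induct) (simp_all add: add vector_field_sum)
  qed
  have "\<exists>w\<in>tangent_space A p. \<forall>Z\<in>vector_fields A. h p w (Z p) = \<omega> Z p" for p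
  proof -
    obtain N y E \<beta> where fr: "local_frame p N y E \<beta>" using local_frame_exists by blast
    note f = local_frameD[OF fr]
    note Ep = vector_field_at[OF f(4)]
    define vec where "vec = (\<lambda>x::'e. \<Sum>c\<in>Basis. fscale (x \<bullet> c) (E c p))"
    have vec: "vec x \<in> tangent_space A p" for x
      unfolding vec_def by (intro tangent_space_sum tangent_space_scale Ep)
    have hv: "h p (vec x) w = (\<Sum>c\<in>Basis. (x \<bullet> c) * h p (E c p) w)"
      if "w \<in> tangent_space A p" for x w
      unfolding vec_def by (rule linear_on_tangent_sum[OF tensor_linear_left[OF h that]]) (rule Ep)
    have hw: "h p v w = (\<Sum>b\<in>Basis. w (y b) * h p v (E b p))"
      if "v \<in> tangent_space A p" "w \<in> tangent_space A p" for v w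
      by (subst f(8)[OF f(2) that(2)], rule linear_on_tangent_sum[OF tensor_linear_right[OF h that(1)]])
         (rule Ep)
    define L where "L = (\<lambda>x::'e. \<Sum>b\<in>Basis. h p (vec x) (E b p) *\<^sub>R b)"
    have Lb: "L x \<bullet> b = h p (vec x) (E b p)" if "b \<in> Basis" for x b
      using that by (simp add: L_def inner_sum_left inner_Basis if_distrib cong: if_cong)
    have "linear L"
    proof (rule linearI)
      have "vec (x + x') = vec x + vec x'" for x x'
        by (simp add: vec_def inner_add_left fspace.scale_left_distrib sum.distrib)
      then show "L (x + x') = L x + L x'" for x x'
        by (simp add: L_def linear_on_tangent_add[OF tensor_linear_left[OF h Ep]] vec
            scaleR_add_left sum.distrib)
      have "vec (c *\<^sub>R x) = fscale c (vec x)" for c x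
        by (simp add: vec_def fspace.scale_sum_right)
      then show "L (c *\<^sub>R x) = c *\<^sub>R L x" for c x
        by (simp add: L_def linear_on_tangent_scale[OF tensor_linear_left[OF h Ep]] vec
            scaleR_sum_right)
    qed
    moreover have "inj L"
      unfolding linear_injective_0[OF \<open>linear L\<close>]
    proof (intro allI impI)
      fix x assume "L x = 0"
      then have "h p (vec x) (E b p) = 0" if "b \<in> Basis" for b
        using Lb[OF that, of x] by simp
      then have "h p (vec x) w = 0" if "w \<in> tangent_space A p" for w
        using hw[OF vec that] by simp
      then have "vec x = 0" by (rule nondeg[OF vec])
      have "x \<bullet> b = 0" if b: "b \<in> Basis" for b
      proof -
        have "vec x (y b) = (\<Sum>c\<in>Basis. (x \<bullet> c) * (if c = b then 1 else 0))"
          using f(9) b by (simp add: vec_def sum_apply fscale_def)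
        then show ?thesis using \<open>vec x = 0\<close> b by (simp add: if_distrib cong: if_cong)
      qed
      then show "x = 0" by (rule euclidean_all_zero_iff[THEN iffD1, rule_format])
    qed
    ultimately obtain x where x: "L x = (\<Sum>b\<in>Basis. \<omega> (E b) p *\<^sub>R b)"
      using linear_injective_imp_surjective by (metis surjD)
    have wE: "h p (vec x) (E b p) = \<omega> (E b) p" if "b \<in> Basis" for b
      using Lb[OF that, of x] that unfolding x
      by (simp add: inner_sum_left inner_Basis if_distrib cong: if_cong)
    show ?thesis
    proof (intro bexI[OF _ vec[of x]] ballI)
      fix Z assume Z: "Z \<in> vector_fields A"
      have aZ: "smooth_fun A (\<lambda>q. \<beta> q * Z q (y b))" for b
        by (intro smooth_fun_mult f(5) vector_field_smooth[OF Z] f(3))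
      have "fscale (\<beta> q) (Z q) = (\<Sum>b\<in>Basis. fscale (\<beta> q * Z q (y b)) (E b q))" for q
      proof (cases "q \<in> N")
        case True
        then have "fscale (\<beta> q) (Z q) = fscale (\<beta> q) (\<Sum>b\<in>Basis. fscale (Z q (y b)) (E b q))"
          using f(8)[OF True vector_field_at[OF Z]] by simp
        then show ?thesis by (simp add: fspace.scale_sum_right)
      qed (simp add: f(7))
      then have "\<omega> (\<lambda>q. fscale (\<beta> q) (Z q)) p =
          \<omega> (\<lambda>q. \<Sum>b\<in>Basis. fscale (\<beta> q * Z q (y b)) (E b q)) p" by simp
      also have "\<dots> = (\<Sum>b\<in>Basis. \<beta> p * Z p (y b) * \<omega> (E b) p)"
        by (subst sum) (simp_all add: vector_field_scale aZ f(4) scale)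
      finally have "\<omega> Z p = (\<Sum>b\<in>Basis. Z p (y b) * \<omega> (E b) p)"
        using scale[OF f(5) Z, of p] f(6) by simp
      then show "h p (vec x) (Z p) = \<omega> Z p"
        using hw[OF vec vector_field_at[OF Z]] wE by simp
    qed
  qed
  then obtain W where W: "\<And>p. W p \<in> tangent_space A p"
      "\<And>p Z. Z \<in> vector_fields A \<Longrightarrow> h p (W p) (Z p) = \<omega> Z p"
    by metis
  have "W \<in> vector_fields A"
    unfolding vector_fields_def
  proof (clarify, intro conjI allI impI W(1) smooth_fun_local)
    fix k p assume k: "smooth_fun A k"
    obtain N y E \<beta> where fr: "local_frame p N y E \<beta>" using local_frame_exists by blast
    note f = local_frameD[OF fr]
    note E = vector_field_at[OF f(4)]
    have "\<exists>N'. open N' \<and> p \<in> N' \<and> (\<forall>c\<in>Basis. smooth_fun_on A N' (\<lambda>q. W q (y c)))"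
    proof (rule smooth_fun_on_solution[where I = Basis and N = N
          and H = "\<lambda>b c q. h q (E c q) (E b q)" and \<omega> = "\<lambda>b. \<omega> (E b)"])
      show "smooth_fun_on A N (\<lambda>q. h q (E c q) (E b q))" for b c
        by (rule smooth_fun_imp_on[OF tensor_smooth[OF h f(4) f(4)]])
      show "smooth_fun_on A N (\<omega> (E b))" for b
        by (rule smooth_fun_imp_on[OF smooth[OF f(4)]])
      show "(\<Sum>c\<in>Basis. h q (E c q) (E b q) * W q (y c)) = \<omega> (E b) q" if "q \<in> N" for b q
      proof -
        have "\<omega> (E b) q = h q (\<Sum>c\<in>Basis. fscale (W q (y c)) (E c q)) (E b q)"
          using W(2)[OF f(4)] f(8)[OF that W(1)] by simp
        then show ?thesis
          by (subst (asm) linear_on_tangent_sum[OF tensor_linear_left[OF h E]])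
             (simp_all add: E mult.commute)
      qed
      fix a :: "'e \<Rightarrow> real" and j :: 'e
      assume a: "\<And>b. b \<in> Basis \<Longrightarrow> (\<Sum>c\<in>Basis. h p (E c p) (E b p) * a c) = 0" and j: "j \<in> Basis"
      define u where "u = (\<Sum>c\<in>Basis. fscale (a c) (E c p))"
      have u: "u \<in> tangent_space A p"
        unfolding u_def by (intro tangent_space_sum tangent_space_scale E)
      have "u = 0"
      proof (rule nondeg[OF u])
        fix w assume w: "w \<in> tangent_space A p"
        have "h p u (E b p) = 0" if "b \<in> Basis" for b
          unfolding u_def
          by (subst linear_on_tangent_sum[OF tensor_linear_left[OF h E]])
             (use a[OF that] in \<open>simp_all add: E mult.commute\<close>)
        then show "h p u w = 0"
          by (subst f(8)[OF f(2) w], subst linear_on_tangent_sum[OF tensor_linear_right[OF h u]])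
             (simp_all add: E)
      qed
      moreover have "u (y j) = (\<Sum>c\<in>Basis. a c * (if c = j then 1 else 0))"
        using f(9) j by (simp add: u_def sum_apply fscale_def)
      ultimately show "a j = 0" using j by (simp add: if_distrib cong: if_cong)
    qed (use f in auto)
    then obtain N' where N': "open N'" "p \<in> N'" "\<And>c. c \<in> Basis \<Longrightarrow> smooth_fun_on A N' (\<lambda>q. W q (y c))"
      by blast
    have o: "open (N \<inter> N')" using f(1) N'(1) by auto
    have "smooth_fun_on A (N \<inter> N') (\<lambda>q. \<Sum>c\<in>Basis. W q (y c) * E c q k)"
      by (intro smooth_fun_on_sum smooth_fun_on_mult o smooth_fun_imp_on[OF vector_field_smooth[OF f(4) k]]
          smooth_fun_on_subset[OF N'(3)]) auto
    then have "smooth_fun_on A (N \<inter> N') (\<lambda>q. W q k)"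
    proof (rule smooth_fun_on_cong[OF o, rotated])
      fix q assume "q \<in> N \<inter> N'"
      then have "W q k = (\<Sum>c\<in>Basis. fscale (W q (y c)) (E c q)) k"
        using f(8)[of q "W q"] W(1) by simp
      then show "(\<Sum>c\<in>Basis. W q (y c) * E c q k) = W q k"
        by (simp add: sum_apply fscale_def)
    qed
    then show "\<exists>N. open N \<and> p \<in> N \<and> smooth_fun_on A N (\<lambda>q. W q k)"
      using o f(2) N'(2) by blast
  qed
  then show ?thesis using W(2) by blast
qed

section \<open>The Koszul expression\<close>

lemma lie_bracket_add_left:
  assumes "X \<in> vector_fields A" "X' \<in> vector_fields A" "Y \<in> vector_fields A"
  shows "lie_bracket (\<lambda>p. X p + X' p) Y p = lie_bracket X Y p + lie_bracket X' Y p"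
proof (rule tangent_eqI)
  show "lie_bracket (\<lambda>p. X p + X' p) Y p \<in> tangent_space A p"
    "lie_bracket X Y p + lie_bracket X' Y p \<in> tangent_space A p"
    by (intro vector_field_at tangent_space_add lie_bracket_vector_field vector_field_add assms)+
  fix f assume "smooth_fun A f"
  then show "lie_bracket (\<lambda>p. X p + X' p) Y p f = (lie_bracket X Y p + lie_bracket X' Y p) f"
    using assms
    by (simp add: lie_bracket_def tangent_add[OF vector_field_at[of Y]] vector_field_smooth)
qed

lemma lie_bracket_scale_left:
  assumes a: "smooth_fun A a" and "X \<in> vector_fields A" "Y \<in> vector_fields A"
  shows "lie_bracket (\<lambda>p. fscale (a p) (X p)) Y p =
    fscale (a p) (lie_bracket X Y p) + fscale (- Y p a) (X p)"
proof (rule tangent_eqI)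
  show "lie_bracket (\<lambda>p. fscale (a p) (X p)) Y p \<in> tangent_space A p"
    "fscale (a p) (lie_bracket X Y p) + fscale (- Y p a) (X p) \<in> tangent_space A p"
    by (intro vector_field_at tangent_space_add tangent_space_scale lie_bracket_vector_field
        vector_field_scale assms)+
  fix f assume "smooth_fun A f"
  then show "lie_bracket (\<lambda>p. fscale (a p) (X p)) Y p f =
      (fscale (a p) (lie_bracket X Y p) + fscale (- Y p a) (X p)) f"
    using assms
    by (simp add: lie_bracket_def fscale_def tangent_mult[OF vector_field_at[of Y]]
        vector_field_smooth algebra_simps)
qed

lemma lie_bracket_swap: "lie_bracket X Y p = fscale (-1) (lie_bracket Y X p)"
  by (auto simp: lie_bracket_def fscale_def)

text \<open>
  For the Levi-Civita connection of a nondegenerate \<open>g\<close> this is \<open>2 g(\<nabla>\<^sub>X Y, Z)\<close>. It is studied here for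
  an arbitrary symmetric tensor field: it is tensorial in \<open>X\<close> and \<open>Z\<close> and satisfies a Leibniz rule in
  \<open>Y\<close>. The rules for \<open>Y\<close> and \<open>Z\<close> are derived from those for \<open>X\<close> through the two swapping identities
  \<open>koszul_swap\<close> and \<open>koszul_swap_last\<close>, which are also what vanishing torsion and metric compatibility
  amount to.
\<close>

definition koszul :: "'m tensor_field2 \<Rightarrow> 'm vfield \<Rightarrow> 'm vfield \<Rightarrow> 'm vfield \<Rightarrow> 'm \<Rightarrow> real" where
  "koszul g X Y Z = (\<lambda>p.
     X p (\<lambda>q. g q (Y q) (Z q)) + Y p (\<lambda>q. g q (X q) (Z q)) - Z p (\<lambda>q. g q (X q) (Y q))
     + g p (lie_bracket X Y p) (Z p) - g p (lie_bracket X Z p) (Y p) - g p (lie_bracket Y Z p) (X p))"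

context
  fixes g :: "'m tensor_field2"
  assumes g: "g \<in> symmetric_tensor_fields A"
begin

lemmas g_left = linear_on_tangent_add[OF tensor_linear_left[OF g]]
  linear_on_tangent_scale[OF tensor_linear_left[OF g]]
lemmas g_right = linear_on_tangent_add[OF tensor_linear_right[OF g]]
  linear_on_tangent_scale[OF tensor_linear_right[OF g]]

lemma tensor_bracket_swap:
  assumes "X \<in> vector_fields A" "Y \<in> vector_fields A" "w \<in> tangent_space A p"
  shows "g p (lie_bracket Y X p) w = - g p (lie_bracket X Y p) w"
  unfolding lie_bracket_swap[of Y X]
  using linear_on_tangent_scale[OF tensor_linear_left[OF g assms(3)], of "lie_bracket X Y p" "-1"]
    vector_field_at[OF lie_bracket_vector_field[OF assms(1,2)]] by simp

lemma koszul_smooth: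
  assumes "X \<in> vector_fields A" "Y \<in> vector_fields A" "Z \<in> vector_fields A"
  shows "smooth_fun A (koszul g X Y Z)"
  unfolding koszul_def
  by (intro smooth_fun_add smooth_fun_diff vector_field_smooth[OF assms(1)]
      vector_field_smooth[OF assms(2)] vector_field_smooth[OF assms(3)]
      tensor_smooth[OF g] lie_bracket_vector_field assms)

lemma koszul_swap:
  assumes "X \<in> vector_fields A" "Y \<in> vector_fields A" "Z \<in> vector_fields A"
  shows "koszul g X Y Z p = koszul g Y X Z p + 2 * g p (lie_bracket X Y p) (Z p)"
proof -
  have s: "g q (X q) (Y q) = g q (Y q) (X q)" for q
    by (intro tensor_sym[OF g] vector_field_at assms)
  show ?thesis
    by (simp add: koszul_def s tensor_bracket_swap[OF assms(1,2) vector_field_at[OF assms(3)]])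
qed

lemma koszul_swap_last:
  assumes "X \<in> vector_fields A" "Y \<in> vector_fields A" "Z \<in> vector_fields A"
  shows "koszul g X Y Z p + koszul g X Z Y p = 2 * X p (\<lambda>q. g q (Y q) (Z q))"
proof -
  have "g q (Y q) (Z q) = g q (Z q) (Y q)" "g q (X q) (Z q) = g q (Z q) (X q)"
    "g q (X q) (Y q) = g q (Y q) (X q)" for q
    by (intro tensor_sym[OF g] vector_field_at assms)+
  then show ?thesis
    by (simp add: koszul_def tensor_bracket_swap[OF assms(2,3) vector_field_at[OF assms(1)]])
qed

lemma koszul_add_first:
  assumes X: "X \<in> vector_fields A" "X' \<in> vector_fields A"
    and Y: "Y \<in> vector_fields A" and Z: "Z \<in> vector_fields A"
  shows "koszul g (\<lambda>p. X p + X' p) Y Z p = koszul g X Y Z p + koszul g X' Y Z p"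
  using assms
  by (simp add: koszul_def g_left g_right lie_bracket_add_left vector_field_at
      lie_bracket_vector_field tensor_smooth[OF g]
      tangent_add[OF vector_field_at[OF Y]] tangent_add[OF vector_field_at[OF Z]])

lemma koszul_scale_first:
  assumes a: "smooth_fun A a" and X: "X \<in> vector_fields A"
    and Y: "Y \<in> vector_fields A" and Z: "Z \<in> vector_fields A"
  shows "koszul g (\<lambda>p. fscale (a p) (X p)) Y Z p = a p * koszul g X Y Z p"
proof -
  have s: "g q (X q) (Y q) = g q (Y q) (X q)" "g q (X q) (Z q) = g q (Z q) (X q)" for q
    by (intro tensor_sym[OF g] vector_field_at assms)+
  show ?thesis
    unfolding koszul_def lie_bracket_scale_left[OF a X Y] lie_bracket_scale_left[OF a X Z]
    using assms
    by (simp add: g_left g_right vector_field_at lie_bracket_vector_field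
        tensor_smooth[OF g] tangent_space_scale
        tangent_mult[OF vector_field_at[OF Y]] tangent_mult[OF vector_field_at[OF Z]]
        del: fspace.scale_minus_left)
       (simp add: fscale_def s algebra_simps)
qed

lemma koszul_add_second:
  assumes "X \<in> vector_fields A" "Y \<in> vector_fields A" "Y' \<in> vector_fields A" "Z \<in> vector_fields A"
  shows "koszul g X (\<lambda>p. Y p + Y' p) Z p = koszul g X Y Z p + koszul g X Y' Z p"
proof -
  note t = vector_field_at[OF assms(1)] vector_field_at[OF assms(2)] vector_field_at[OF assms(3)]
    vector_field_at[OF assms(4)]
  have br: "lie_bracket X (\<lambda>p. Y p + Y' p) p = lie_bracket X Y p + lie_bracket X Y' p"
    using lie_bracket_swap[of X _ p] lie_bracket_add_left[OF assms(2,3,1), of p]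
    by (simp add: fspace.scale_right_distrib del: fspace.scale_minus_left)
  show ?thesis
    unfolding koszul_swap[OF assms(1) vector_field_add[OF assms(2,3)] assms(4)]
      koszul_swap[OF assms(1,2,4)] koszul_swap[OF assms(1,3,4)] koszul_add_first[OF assms(2,3,1,4)] br
    by (simp add: g_left t vector_field_at lie_bracket_vector_field assms)
qed

lemma koszul_scale_second:
  assumes a: "smooth_fun A a"
    and X: "X \<in> vector_fields A" and Y: "Y \<in> vector_fields A" and Z: "Z \<in> vector_fields A"
  shows "koszul g X (\<lambda>p. fscale (a p) (Y p)) Z p =
    a p * koszul g X Y Z p + 2 * X p a * g p (Y p) (Z p)"
proof -
  have "lie_bracket X (\<lambda>p. fscale (a p) (Y p)) p =
      fscale (a p) (lie_bracket X Y p) + fscale (X p a) (Y p)"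
    unfolding lie_bracket_swap[of X _ p] lie_bracket_scale_left[OF a Y X]
    by (simp add: fscale_def fun_eq_iff algebra_simps)
  then have "g p (lie_bracket X (\<lambda>p. fscale (a p) (Y p)) p) (Z p) =
      a p * g p (lie_bracket X Y p) (Z p) + X p a * g p (Y p) (Z p)"
    using assms by (simp add: g_left vector_field_at lie_bracket_vector_field tangent_space_scale)
  then show ?thesis
    unfolding koszul_swap[OF X vector_field_scale[OF a Y] Z] koszul_swap[OF X Y Z]
      koszul_scale_first[OF a Y X Z]
    by (simp add: algebra_simps)
qed

lemma koszul_add_third:
  assumes "X \<in> vector_fields A" "Y \<in> vector_fields A" "Z \<in> vector_fields A" "Z' \<in> vector_fields A"
  shows "koszul g X Y (\<lambda>p. Z p + Z' p) p = koszul g X Y Z p + koszul g X Y Z' p"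
proof -
  have "X p (\<lambda>q. g q (Y q) (Z q + Z' q)) =
      X p (\<lambda>q. g q (Y q) (Z q)) + X p (\<lambda>q. g q (Y q) (Z' q))"
    using assms by (simp add: g_right vector_field_at tensor_smooth[OF g]
        tangent_add[OF vector_field_at[OF assms(1)]])
  then show ?thesis
    using koszul_swap_last[OF assms(1,2) vector_field_add[OF assms(3,4)], of p]
      koszul_swap_last[OF assms(1,2,3), of p] koszul_swap_last[OF assms(1,2,4), of p]
      koszul_add_second[OF assms(1,3,4,2), of p]
    by linarith
qed

lemma koszul_scale_third:
  assumes a: "smooth_fun A a"
    and X: "X \<in> vector_fields A" and Y: "Y \<in> vector_fields A" and Z: "Z \<in> vector_fields A"
  shows "koszul g X Y (\<lambda>p. fscale (a p) (Z p)) p = a p * koszul g X Y Z p"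
proof -
  have "X p (\<lambda>q. g q (Y q) (fscale (a q) (Z q))) =
      a p * X p (\<lambda>q. g q (Y q) (Z q)) + g p (Y p) (Z p) * X p a"
    using assms by (simp add: g_right vector_field_at tensor_smooth[OF g]
        tangent_mult[OF vector_field_at[OF X]])
  moreover have "g p (Z p) (Y p) = g p (Y p) (Z p)"
    by (intro tensor_sym[OF g] vector_field_at Y Z)
  moreover have "a p * (koszul g X Y Z p + koszul g X Z Y p) = a p * (2 * X p (\<lambda>q. g q (Y q) (Z q)))"
    by (simp only: koszul_swap_last[OF X Y Z])
  ultimately show ?thesis
    using koszul_swap_last[OF X Y vector_field_scale[OF a Z], of p]
      koszul_scale_second[OF a X Z Y, of p]
    by (simp add: algebra_simps)
qed

text \<open>
  Compatibility rewrites each derivative of \<open>g\<close> by \<open>D\<close>, and vanishing torsion rewrites each bracket; all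
  terms cancel except two copies of \<open>g(D\<^sub>X Y, Z)\<close>.
\<close>

lemma koszul_formula:
  assumes D: "\<And>X Y. X \<in> vector_fields A \<Longrightarrow> Y \<in> vector_fields A \<Longrightarrow> D X Y \<in> vector_fields A"
    and tf: "torsion_free A D" and mc: "metric_compatible A g D"
    and X: "X \<in> vector_fields A" and Y: "Y \<in> vector_fields A" and Z: "Z \<in> vector_fields A"
  shows "2 * g p (D X Y p) (Z p) = koszul g X Y Z p"
proof -
  have d: "U p (\<lambda>q. g q (V q) (W q)) = g p (D U V p) (W p) + g p (V p) (D U W p)"
    if "U \<in> vector_fields A" "V \<in> vector_fields A" "W \<in> vector_fields A" for U V W
  proof -
    have "U p (\<lambda>q. g q (V q) (W q)) - g p (D U V p) (W p) - g p (V p) (D U W p) = 0"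
      using mc that unfolding metric_compatible_def cov_deriv_tensor_def by blast
    then show ?thesis by simp
  qed
  have b: "g p (lie_bracket U V p) (W p) = g p (D U V p) (W p) - g p (D V U p) (W p)"
    if "U \<in> vector_fields A" "V \<in> vector_fields A" "W \<in> vector_fields A" for U V W
  proof -
    have "D U V p = lie_bracket U V p + D V U p"
      using tf that unfolding torsion_free_def by (metis diff_add_cancel)
    then have "g p (D U V p) (W p) = g p (lie_bracket U V p) (W p) + g p (D V U p) (W p)"
      using that by (simp add: g_left vector_field_at D lie_bracket_vector_field)
    then show ?thesis by simp
  qed
  have s: "g p (Y p) (D X Z p) = g p (D X Z p) (Y p)" "g p (X p) (D Y Z p) = g p (D Y Z p) (X p)"
    "g p (X p) (D Z Y p) = g p (D Z Y p) (X p)"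
    by (intro tensor_sym[OF g] vector_field_at D X Y Z)+
  show ?thesis
    unfolding koszul_def d[OF X Y Z] d[OF Y X Z] d[OF Z X Y] b[OF X Y Z] b[OF X Z Y] b[OF Y Z X] s
    by simp
qed

end

section \<open>One-forms and spanning sets of the radical\<close>

lemma one_form_linear: "\<tau> \<in> one_forms A \<Longrightarrow> linear_on_tangent A p (\<tau> p)"
  by (simp add: one_forms_def)

lemma one_form_smooth: "\<tau> \<in> one_forms A \<Longrightarrow> X \<in> vector_fields A \<Longrightarrow> smooth_fun A (\<lambda>p. \<tau> p (X p))"
  by (simp add: one_forms_def)

text \<open>
  The space of all functionals is infinite-dimensional, so the usual dimension count needs the finite
  frame at \<open>p\<close> to know that a basis of \<open>V\<close> is finite.
\<close>

lemma independent_card_dim_spans: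
  assumes "V \<subseteq> tangent_space A p" "B \<subseteq> V" "finite B" "fspace.independent B" "card B = fspace.dim V"
  shows "V \<subseteq> fspace.span B"
proof
  fix v assume v: "v \<in> V"
  obtain N y E \<beta> where fr: "local_frame p N y E \<beta>" using local_frame_exists by blast
  note f = local_frameD[OF fr]
  let ?F = "(\<lambda>b. E b p) ` Basis"
  have tF: "tangent_space A p \<subseteq> fspace.span ?F"
  proof
    fix v assume "v \<in> tangent_space A p"
    then have v: "v = (\<Sum>b\<in>Basis. fscale (v (y b)) (E b p))" by (rule f(8)[OF f(2)])
    show "v \<in> fspace.span ?F"
      by (subst v) (intro fspace.span_sum fspace.span_scale fspace.span_base imageI)
  qed
  obtain C where C: "C \<subseteq> V" "fspace.independent C" "V \<subseteq> fspace.span C" "card C = fspace.dim V"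
    using fspace.basis_exists by blast
  have "finite C"
    using fspace.independent_span_bound[of ?F C] C(1,2) tF assms(1) by auto
  show "v \<in> fspace.span B"
  proof (rule ccontr)
    assume nv: "v \<notin> fspace.span B"
    then have "fspace.independent (insert v B)"
      using assms(4) by (simp add: fspace.independent_insert)
    then have "card (insert v B) \<le> card C"
      using fspace.independent_span_bound[OF \<open>finite C\<close>] C(3) v assms(2) by blast
    moreover have "v \<notin> B" using nv fspace.span_base by blast
    ultimately show False using assms(3,5) C(4) by simp
  qed
qed

end

section \<open>The connection\<close>

locale lightlike_parallelism = smooth_manifold A
  for A :: "('m::{t2_space, second_countable_topology}, 'e::euclidean_space) chart set" +
  fixes g :: "'m tensor_field2" and r :: nat
    and \<xi> :: "nat \<Rightarrow> 'm vfield" and \<tau> :: "nat \<Rightarrow> 'm covector_field"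
  assumes g: "g \<in> symmetric_tensor_fields A"
    and nullity: "\<And>p. nullity_degree A g p = r"
    and xi: "\<And>i. i \<in> {1..r} \<Longrightarrow> \<xi> i \<in> radical_sections A g"
    and xi_indep: "\<And>p. inj_on (\<lambda>i. \<xi> i p) {1..r} \<and> fspace.independent ((\<lambda>i. \<xi> i p) ` {1..r})"
    and tau: "\<And>i. i \<in> {1..r} \<Longrightarrow> \<tau> i \<in> one_forms A"
    and dual: "\<And>i j p. i \<in> {1..r} \<Longrightarrow> j \<in> {1..r} \<Longrightarrow> \<tau> i p (\<xi> j p) = (if i = j then 1 else 0)"
    and closed: "\<And>i. i \<in> {1..r} \<Longrightarrow> closed_form A (\<tau> i)"
    and killing: "\<And>i X Y p. i \<in> {1..r} \<Longrightarrow> X \<in> vector_fields A \<Longrightarrow> Y \<in> vector_fields A \<Longrightarrow>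
      lie_deriv (\<xi> i) g X Y p = 0"
begin

lemma xi_vector_field: "i \<in> {1..r} \<Longrightarrow> \<xi> i \<in> vector_fields A"
  using xi by (simp add: radical_sections_def)

lemma xi_null: "i \<in> {1..r} \<Longrightarrow> w \<in> tangent_space A p \<Longrightarrow> g p (\<xi> i p) w = 0"
  using xi by (auto simp: radical_sections_def radical_def)

lemma xi_null': "i \<in> {1..r} \<Longrightarrow> w \<in> tangent_space A p \<Longrightarrow> g p w (\<xi> i p) = 0"
  using xi_null tensor_sym[OF g, of w p "\<xi> i p"] vector_field_at[OF xi_vector_field] by metis

text \<open>
  Adding the squares of the \<open>\<tau>\<^sub>i\<close> repairs the degeneracy of \<open>g\<close> along the radical; the \<open>\<xi>\<^sub>i\<close> become
  the duals of the forms \<open>\<tau>\<^sub>i\<close> under this metric.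
\<close>

definition total_metric :: "'m tensor_field2" where
  "total_metric p v w = g p v w + (\<Sum>i=1..r. \<tau> i p v * \<tau> i p w)"

lemmas tau_add = linear_on_tangent_add[OF one_form_linear[OF tau]]
lemmas tau_scale = linear_on_tangent_scale[OF one_form_linear[OF tau]]

lemma total_metric_tensor: "total_metric \<in> symmetric_tensor_fields A"
  unfolding symmetric_tensor_fields_def
proof (intro CollectI conjI allI ballI)
  fix p v assume v: "v \<in> tangent_space A p"
  show "linear_on_tangent A p (total_metric p v)"
    using tensor_linear_right[OF g v]
    by (auto simp: linear_on_tangent_def total_metric_def tau_add tau_scale sum.distrib
        sum_distrib_left algebra_simps)
next
  fix p v w assume "v \<in> tangent_space A p" "w \<in> tangent_space A p"
  then show "total_metric p v w = total_metric p w v"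
    using tensor_sym[OF g] by (simp add: total_metric_def mult.commute)
next
  fix X Y assume X: "X \<in> vector_fields A" and Y: "Y \<in> vector_fields A"
  show "smooth_fun A (\<lambda>p. total_metric p (X p) (Y p))"
    unfolding total_metric_def
    by (intro smooth_fun_add smooth_fun_sum smooth_fun_mult tensor_smooth[OF g X Y]
        one_form_smooth[OF tau X] one_form_smooth[OF tau Y])
qed

lemma total_metric_xi:
  assumes "i \<in> {1..r}" "v \<in> tangent_space A p"
  shows "total_metric p v (\<xi> i p) = \<tau> i p v"
proof -
  have "total_metric p v (\<xi> i p) = (\<Sum>j=1..r. \<tau> j p v * (if j = i then 1 else 0))"
    using assms by (simp add: total_metric_def xi_null' dual)
  then show ?thesis using assms(1) by (simp add: if_distrib cong: if_cong)
qed

text \<open>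
  Testing with \<open>\<xi>\<^sub>i\<close> gives \<open>\<tau>\<^sub>i(v) = 0\<close>, so \<open>v\<close> is in the radical. The \<open>r\<close> independent vectors \<open>\<xi>\<^sub>i\<close>
  span the radical, whose dimension is the nullity degree \<open>r\<close>, and the \<open>\<tau>\<^sub>i\<close> read off the
  coefficients of \<open>v\<close>.
\<close>

lemma total_metric_nondegenerate:
  assumes v: "v \<in> tangent_space A p" and 0: "\<And>w. w \<in> tangent_space A p \<Longrightarrow> total_metric p v w = 0"
  shows "v = 0"
proof -
  have t0: "\<tau> i p v = 0" if "i \<in> {1..r}" for i
    using total_metric_xi[OF that v] 0 vector_field_at[OF xi_vector_field[OF that]] by simp
  have "g p v w = 0" if "w \<in> tangent_space A p" for w
    using 0[OF that] t0 by (simp add: total_metric_def)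
  then have vr: "v \<in> radical A g p" using v by (simp add: radical_def)
  have "radical A g p \<subseteq> fspace.span ((\<lambda>i. \<xi> i p) ` {1..r})"
  proof (rule independent_card_dim_spans)
    show "radical A g p \<subseteq> tangent_space A p" by (auto simp: radical_def)
    show "(\<lambda>i. \<xi> i p) ` {1..r} \<subseteq> radical A g p" using xi by (auto simp: radical_sections_def)
    show "card ((\<lambda>i. \<xi> i p) ` {1..r}) = fspace.dim (radical A g p)"
      using xi_indep[of p] nullity[of p] by (simp add: card_image nullity_degree_def)
  qed (use xi_indep[of p] in auto)
  then have "v \<in> fspace.span ((\<lambda>i. \<xi> i p) ` {1..r})" using vr by blast
  then obtain u where u: "v = (\<Sum>w\<in>(\<lambda>i. \<xi> i p) ` {1..r}. fscale (u w) w)"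
    by (auto simp: fspace.span_finite)
  then have v_eq: "v = (\<Sum>i=1..r. fscale (u (\<xi> i p)) (\<xi> i p))"
    using xi_indep[of p] by (simp add: sum.reindex)
  have "u (\<xi> j p) = 0" if j: "j \<in> {1..r}" for j
  proof -
    have "\<tau> j p v = (\<Sum>i=1..r. u (\<xi> i p) * \<tau> j p (\<xi> i p))"
      unfolding v_eq
      by (rule linear_on_tangent_sum[OF one_form_linear[OF tau[OF j]]])
         (rule vector_field_at[OF xi_vector_field])
    also have "\<dots> = (\<Sum>i=1..r. u (\<xi> i p) * (if i = j then 1 else 0))"
      by (rule sum.cong) (use dual j in auto)
    also have "\<dots> = u (\<xi> j p)" using j by (simp add: if_distrib cong: if_cong)
    finally show ?thesis using t0[OF j] by simp
  qed
  then show "v = 0" by (subst v_eq) simp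
qed

text \<open>
  Terms that pair \<open>\<xi>\<^sub>i\<close> with another field vanish, and what is left is \<open>-(L\<^sub>Z g)(X, Y)\<close> for \<open>Z = \<xi>\<^sub>i\<close>. This is the
  obstruction to solving the Koszul identity for a degenerate \<open>g\<close>.
\<close>

lemma koszul_xi:
  assumes i: "i \<in> {1..r}" and X: "X \<in> vector_fields A" and Y: "Y \<in> vector_fields A"
  shows "koszul g X Y (\<xi> i) p = 0"
proof -
  note \<xi> = xi_vector_field[OF i]
  have s: "g p (lie_bracket (\<xi> i) Y p) (X p) = g p (X p) (lie_bracket (\<xi> i) Y p)"
    by (intro tensor_sym[OF g] vector_field_at X lie_bracket_vector_field \<xi> Y)
  show ?thesis
    using killing[OF i X Y, of p]
    by (simp add: koszul_def lie_deriv_def xi_null'[OF i] vector_field_at X Y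
        lie_bracket_vector_field tangent_const[OF vector_field_at[OF X]]
        tangent_const[OF vector_field_at[OF Y]] s
        tensor_bracket_swap[OF g \<xi> X vector_field_at[OF Y]]
        tensor_bracket_swap[OF g \<xi> Y vector_field_at[OF X]])
qed

text \<open>
  The properties forced on \<open>W = \<nabla>\<^sub>X Y\<close>. The connection axioms and the vanishing of the
  torsion are proved by checking that both sides of an equation have them.
\<close>

definition covariant :: "'m vfield \<Rightarrow> 'm vfield \<Rightarrow> 'm vfield \<Rightarrow> bool" where
  "covariant X Y W \<longleftrightarrow> W \<in> vector_fields A \<and>
     (\<forall>Z\<in>vector_fields A. \<forall>p. 2 * g p (W p) (Z p) = koszul g X Y Z p) \<and>
     (\<forall>i\<in>{1..r}. \<forall>p. \<tau> i p (W p) = X p (\<lambda>q. \<tau> i q (Y q)))"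

lemma covariantI:
  assumes "W \<in> vector_fields A"
    "\<And>Z p. Z \<in> vector_fields A \<Longrightarrow> 2 * g p (W p) (Z p) = koszul g X Y Z p"
    "\<And>i p. i \<in> {1..r} \<Longrightarrow> \<tau> i p (W p) = X p (\<lambda>q. \<tau> i q (Y q))"
  shows "covariant X Y W"
  using assms by (simp add: covariant_def)

lemma covariantD:
  assumes "covariant X Y W"
  shows "W \<in> vector_fields A"
    "Z \<in> vector_fields A \<Longrightarrow> 2 * g p (W p) (Z p) = koszul g X Y Z p"
    "i \<in> {1..r} \<Longrightarrow> \<tau> i p (W p) = X p (\<lambda>q. \<tau> i q (Y q))"
  using assms unfolding covariant_def by blast+

lemma covariant_unique:
  assumes "covariant X Y W" "covariant X Y W'"
  shows "W = W'"
proof (rule nondegenerate_eqI[OF total_metric_tensor total_metric_nondegenerate])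
  fix Z p assume Z: "Z \<in> vector_fields A"
  have "2 * g p (W p) (Z p) = 2 * g p (W' p) (Z p)"
    by (simp only: assms[THEN covariantD(2)] Z)
  then show "total_metric p (W p) (Z p) = total_metric p (W' p) (Z p)"
    by (simp add: total_metric_def assms[THEN covariantD(3)])
qed (use assms[THEN covariantD(1)] in auto)

text \<open>
  The right-hand side \<open>?\<omega>\<close> is the value that the two properties prescribe for \<open>h(W, Z)\<close>. Conversely, its
  \<open>h\<close>-dual has both: \<open>Z = \<xi>\<^sub>i\<close> isolates \<open>\<tau>\<^sub>i(W)\<close>, thanks to \<open>koszul_xi\<close>.
\<close>

lemma covariant_exists:
  assumes X: "X \<in> vector_fields A" and Y: "Y \<in> vector_fields A"
  shows "\<exists>W. covariant X Y W"
proof -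
  let ?\<omega> = "\<lambda>Z p. (1 / 2) * koszul g X Y Z p + (\<Sum>i=1..r. X p (\<lambda>q. \<tau> i q (Y q)) * \<tau> i p (Z p))"
  have "\<exists>W\<in>vector_fields A. \<forall>Z\<in>vector_fields A. \<forall>p. total_metric p (W p) (Z p) = ?\<omega> Z p"
  proof (rule sharp_exists[OF total_metric_tensor total_metric_nondegenerate])
    show "?\<omega> (\<lambda>p. Z p + Z' p) p = ?\<omega> Z p + ?\<omega> Z' p"
      if "Z \<in> vector_fields A" "Z' \<in> vector_fields A" for Z Z' p
      using that by (simp add: koszul_add_third[OF g X Y] tau_add vector_field_at
          sum.distrib algebra_simps add_divide_distrib)
    show "?\<omega> (\<lambda>p. fscale (f p) (Z p)) p = f p * ?\<omega> Z p"
      if "smooth_fun A f" "Z \<in> vector_fields A" for f Z p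
      using that by (simp add: koszul_scale_third[OF g _ X Y] tau_scale vector_field_at
          sum_distrib_left algebra_simps)
    show "smooth_fun A (?\<omega> Z)" if "Z \<in> vector_fields A" for Z
      using that by (intro smooth_fun_add smooth_fun_sum smooth_fun_mult smooth_fun_const
          koszul_smooth[OF g X Y] vector_field_smooth[OF X] one_form_smooth[OF tau] Y)
  qed
  then obtain W where W: "W \<in> vector_fields A"
    and hW: "\<And>Z p. Z \<in> vector_fields A \<Longrightarrow> total_metric p (W p) (Z p) = ?\<omega> Z p" by blast
  have t: "\<tau> i p (W p) = X p (\<lambda>q. \<tau> i q (Y q))" if i: "i \<in> {1..r}" for i p
  proof -
    have "\<tau> i p (W p) = ?\<omega> (\<xi> i) p"
      using hW[OF xi_vector_field[OF i]] total_metric_xi[OF i vector_field_at[OF W]] by simp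
    also have "\<dots> = (\<Sum>j=1..r. X p (\<lambda>q. \<tau> j q (Y q)) * (if j = i then 1 else 0))"
      using i by (simp add: koszul_xi[OF i X Y] dual)
    finally show ?thesis using i by (simp add: if_distrib cong: if_cong)
  qed
  have "covariant X Y W"
  proof (rule covariantI[OF W _ t])
    show "2 * g p (W p) (Z p) = koszul g X Y Z p" if "Z \<in> vector_fields A" for Z p
      using hW[OF that, of p] by (simp add: total_metric_def t)
  qed auto
  then show ?thesis by blast
qed

text \<open>
  Restricted to smooth vector fields in both arguments, as the extensional function spaces in the
  notion of a linear connection require.
\<close>

definition connection :: "'m connection" where
  "connection = (\<lambda>X\<in>vector_fields A. \<lambda>Y\<in>vector_fields A. THE W. covariant X Y W)"

lemma connection_covariant:
  assumes "X \<in> vector_fields A" "Y \<in> vector_fields A"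
  shows "covariant X Y (connection X Y)"
proof -
  have "\<exists>!W. covariant X Y W" using covariant_exists[OF assms] covariant_unique by blast
  then show ?thesis using assms theI'[of "covariant X Y"] by (simp add: connection_def)
qed

lemma connection_eqI:
  "X \<in> vector_fields A \<Longrightarrow> Y \<in> vector_fields A \<Longrightarrow> covariant X Y W \<Longrightarrow> connection X Y = W"
  using covariant_unique connection_covariant by blast

lemmas connection_vector_field = covariantD(1)[OF connection_covariant]
lemmas connection_metric = covariantD(2)[OF connection_covariant]
lemmas connection_form = covariantD(3)[OF connection_covariant]

lemma linear_connection_connection: "linear_connection A connection"
  unfolding linear_connection_def
proof (intro conjI ballI allI impI)
  show "connection \<in> vector_fields A \<rightarrow>\<^sub>E (vector_fields A \<rightarrow>\<^sub>E vector_fields A)"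
    using connection_vector_field by (auto simp: connection_def)
next
  fix X X' Y assume v: "X \<in> vector_fields A" "X' \<in> vector_fields A" "Y \<in> vector_fields A"
  show "connection (\<lambda>p. X p + X' p) Y = (\<lambda>p. connection X Y p + connection X' Y p)"
    by (intro connection_eqI covariantI vector_field_add connection_vector_field v)
       (simp_all add: g_left[OF g] connection_metric koszul_add_first[OF g] connection_form
         connection_vector_field vector_field_at tau_add v distrib_left)
next
  fix f X Y assume f: "smooth_fun A f" and v: "X \<in> vector_fields A" "Y \<in> vector_fields A"
  have scaled: "fscale (f p) (X p) h = f p * X p h" for p h by (simp add: fscale_def)
  show "connection (\<lambda>p. fscale (f p) (X p)) Y = (\<lambda>p. fscale (f p) (connection X Y p))"
    by (intro connection_eqI covariantI vector_field_scale connection_vector_field v f)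
       (simp_all add: g_left[OF g] koszul_scale_first[OF g f] connection_form
         connection_vector_field vector_field_at tau_scale v scaled
         flip: connection_metric)
next
  fix X Y Y' assume v: "X \<in> vector_fields A" "Y \<in> vector_fields A" "Y' \<in> vector_fields A"
  show "connection X (\<lambda>p. Y p + Y' p) = (\<lambda>p. connection X Y p + connection X Y' p)"
    by (intro connection_eqI covariantI vector_field_add connection_vector_field v)
       (simp_all add: g_left[OF g] connection_metric koszul_add_second[OF g] connection_form
         connection_vector_field vector_field_at tau_add v distrib_left
         tangent_add[OF vector_field_at[OF v(1)]] one_form_smooth[OF tau])
next
  fix f X Y assume f: "smooth_fun A f" and v: "X \<in> vector_fields A" "Y \<in> vector_fields A"
  note W = vector_field_add[OF vector_field_scale[OF vector_field_smooth[OF v(1) f] v(2)]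
      vector_field_scale[OF f connection_vector_field[OF v]]]
  show "connection X (\<lambda>p. fscale (f p) (Y p)) =
      (\<lambda>p. fscale (X p f) (Y p) + fscale (f p) (connection X Y p))"
    by (rule connection_eqI[OF v(1) vector_field_scale[OF f v(2)]], rule covariantI[OF W])
       (simp_all add: g_left[OF g] koszul_scale_second[OF g f] connection_form
         connection_vector_field vector_field_at tau_add tau_scale v distrib_left
         tangent_space_scale tangent_mult[OF vector_field_at[OF v(1)]] one_form_smooth[OF tau] f
         flip: connection_metric)
qed

lemma torsion_free_connection: "torsion_free A connection"
  unfolding torsion_free_def
proof (intro ballI allI)
  fix X Y p assume v: "X \<in> vector_fields A" "Y \<in> vector_fields A"
  note b = lie_bracket_vector_field[OF v]
  have "\<tau> i p (lie_bracket X Y p) = X p (\<lambda>q. \<tau> i q (Y q)) - Y p (\<lambda>q. \<tau> i q (X q))"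
    if "i \<in> {1..r}" for i p
    using closed[OF that] v unfolding closed_form_def ext_deriv_def by force
  then have "connection X Y = (\<lambda>p. connection Y X p + lie_bracket X Y p)"
    by (intro connection_eqI covariantI vector_field_add connection_vector_field v b)
       (simp_all add: g_left[OF g] koszul_swap[OF g v] connection_form connection_metric
         connection_vector_field vector_field_at tau_add v b distrib_left)
  then show "connection X Y p - connection Y X p = lie_bracket X Y p" by simp
qed

lemma metric_compatible_connection: "metric_compatible A g connection"
  unfolding metric_compatible_def
proof (intro ballI allI)
  fix Z X Y p assume v: "Z \<in> vector_fields A" "X \<in> vector_fields A" "Y \<in> vector_fields A"
  have "g p (X p) (connection Z Y p) = g p (connection Z Y p) (X p)"
    by (intro tensor_sym[OF g] vector_field_at connection_vector_field v)
  then show "cov_deriv_tensor connection g Z X Y p = 0"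
    using koszul_swap_last[OF g v, of p] connection_metric[OF v, of p]
      connection_metric[OF v(1,3,2), of p]
    by (simp add: cov_deriv_tensor_def)
qed

lemma parallel_form_connection: "i \<in> {1..r} \<Longrightarrow> parallel_form A connection (\<tau> i)"
  by (simp add: parallel_form_def cov_deriv_form_def connection_form)

lemma connection_unique:
  assumes lc: "linear_connection A D" and tf: "torsion_free A D" and mc: "metric_compatible A g D"
    and pf: "\<And>i. i \<in> {1..r} \<Longrightarrow> parallel_form A D (\<tau> i)"
  shows "D = connection"
proof -
  have D: "D \<in> vector_fields A \<rightarrow>\<^sub>E (vector_fields A \<rightarrow>\<^sub>E vector_fields A)"
    using lc by (simp add: linear_connection_def)
  have Dv: "D X Y \<in> vector_fields A" if "X \<in> vector_fields A" "Y \<in> vector_fields A" for X Y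
    by (rule PiE_mem[OF PiE_mem[OF D that(1)] that(2)])
  have eq: "D X Y = connection X Y" if v: "X \<in> vector_fields A" "Y \<in> vector_fields A" for X Y
  proof (rule connection_eqI[OF v, symmetric], rule covariantI)
    show "2 * g p (D X Y p) (Z p) = koszul g X Y Z p" if "Z \<in> vector_fields A" for Z p
      by (rule koszul_formula[OF g Dv tf mc v that])
    show "\<tau> i p (D X Y p) = X p (\<lambda>q. \<tau> i q (Y q))" if "i \<in> {1..r}" for i p
      using pf[OF that] v unfolding parallel_form_def cov_deriv_form_def by force
  qed (rule Dv[OF v])
  have C: "connection \<in> vector_fields A \<rightarrow>\<^sub>E (vector_fields A \<rightarrow>\<^sub>E vector_fields A)"
    using linear_connection_connection by (simp add: linear_connection_def)
  show ?thesis
  proof (rule PiE_ext[OF D C])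
    fix X assume X: "X \<in> vector_fields A"
    show "D X = connection X"
      by (rule PiE_ext[OF PiE_mem[OF D X] PiE_mem[OF C X]]) (rule eq[OF X])
  qed
qed

end

theorem corollary1p6:
  fixes A :: "('m::{t2_space, second_countable_topology}, 'e::euclidean_space) chart set"
    and g :: "'m tensor_field2"
    and \<nu> r :: nat
    and \<xi> :: "nat \<Rightarrow> 'm vfield"
    and \<tau> :: "nat \<Rightarrow> 'm covector_field"
  assumes light_like: "light_like_manifold A g \<nu> r"
    and xi_radical: "\<And>i. i \<in> {1..r} \<Longrightarrow> \<xi> i \<in> radical_sections A g"
    and xi_independent:
      "\<And>p. inj_on (\<lambda>i. \<xi> i p) {1..r} \<and> fspace.independent ((\<lambda>i. \<xi> i p) ` {1..r})"
    and tau_form: "\<And>i. i \<in> {1..r} \<Longrightarrow> \<tau> i \<in> one_forms A"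
    and tau_dual: "\<And>i j p. i \<in> {1..r} \<Longrightarrow> j \<in> {1..r} \<Longrightarrow>
      \<tau> i p (\<xi> j p) = (if i = j then 1 else 0)"
    and tau_closed: "\<And>i. i \<in> {1..r} \<Longrightarrow> closed_form A (\<tau> i)"
    and xi_killing: "\<And>i X Y p. i \<in> {1..r} \<Longrightarrow> X \<in> vector_fields A \<Longrightarrow> Y \<in> vector_fields A \<Longrightarrow>
      lie_deriv (\<xi> i) g X Y p = 0"
  shows "\<exists>!D. linear_connection A D \<and> torsion_free A D \<and> metric_compatible A g D \<and>
    (\<forall>i\<in>{1..r}. parallel_form A D (\<tau> i))"
proof -
  interpret lightlike_parallelism A g r \<xi> \<tau>
    using assms by unfold_locales (auto simp: light_like_manifold_def)
  show ?thesis
    using linear_connection_connection torsion_free_connection metric_compatible_connection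
      parallel_form_connection connection_unique by blast
qed

end
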